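(* Let $(E_6)^{\gamma}=\{\alpha\in E_6\mid \gamma\alpha\gamma=\alpha\}$ and $(E_6)^{\gamma_H\rho_2}=\{\alpha\in E_6\mid (\gamma_H\rho_2)\alpha(\gamma_H\rho_2)^{-1}=\alpha\}$. Then $$(E_6)^{\gamma}\cap (E_6)^{\gamma_H\rho_2}\;\cong\;(U(1)\times U(1)\times SU(5))/(\mathbf{Z}_2\times\mathbf{Z}_5),$$ where $\mathbf{Z}_2=\{(1,1,E),(-1,-1,E)\}$ and $\mathbf{Z}_5=\{(1,\nu^k,\nu^kE)\mid k=0,1,2,3,4\}$, $\nu$ a primitive fifth root of unity.
   Context: Let $\mathbf{H}$ be the quaternions with basis $1,e_1,e_2,e_3=e_1e_2$, $\mathbf{C}=\mathbf{R}\oplus\mathbf{R}e_1$, $\mathbf{H}=\mathbf{C}\oplus\mathbf{C}e_2$, and $\mathfrak{C}=\mathbf{H}\oplus\mathbf{H}e_4$ the division Cayley algebra with product $(m+ae_4)(n+be_4)=(mn-\overline{b}a)+(a\overline{n}+bm)e_4$. Let $\mathfrak{J}=\{X\in M(3,\mathfrak{C})\mid X^*=X\}$, with elements $X=\begin{pmatrix}\xi_1&x_3&\overline{x}_2\\ \overline{x}_3&\xi_2&x_1\\ x_2&\overline{x}_1&\xi_3\end{pmatrix}$, and let $\mathfrak{J}^C=\mathfrak{J}\oplus i\mathfrak{J}$ be its complexification ($C=\mathbf{R}\oplus\mathbf{R}i$; then $\xi_k\in C$, $x_k\in\mathfrak{C}^C$ and $\overline{x}$ is the $C$-linear extension of octonion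 conjugation), with $X\circ Y=\frac12(XY+YX)$, $(X,Y)=\mathrm{tr}(X\circ Y)$, $X\times Y=\frac12\big(2X\circ Y-\mathrm{tr}(X)Y-\mathrm{tr}(Y)X+(\mathrm{tr}(X)\mathrm{tr}(Y)-(X,Y))E\big)$, $\det X=\frac13(X,X\times X)$, complex conjugation $\tau(X+iY)=X-iY$ ($X,Y\in\mathfrak{J}$), and $\langle X,Y\rangle=(\tau X,Y)$. Then $E_6=\{\alpha\in\mathrm{Iso}_C(\mathfrak{J}^C)\mid \det\alpha X=\det X,\ \langle\alpha X,\alpha Y\rangle=\langle X,Y\rangle\}$. On $\mathfrak{C}$ define $\gamma(x+ye_4)=x-ye_4$ ($x,y\in\mathbf{H}$); on $\mathbf{H}$ put $\gamma_H(a+be_2)=a-be_2$ ($a,b\in\mathbf{C}$), extended by $\gamma_H(x+ye_4)=\gamma_Hx+(\gamma_Hy)e_4$. Acting entrywise and $C$-linearly these give involutive elements $\gamma,\gamma_H\in E_6$. The involutive element $\rho_2\in E_6$ is the $C$-linear map of $\mathfrak{J}^C$ given in coordinates by $$(\xi_1,\xi_2,\xi_3;x_1,x_2,x_3)\mapsto(\xi_1,-\xi_2,-\xi_3;\ e_1x_1e_1,\ i\,e_1x_2,\ -i\,x_3e_1).$$ The element $\gamma_H\rho_2$ is an involution commuting with $\gamma$. *)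

theory Defs
  imports "HOL-Analysis.Analysis" "HOL-Algebra.Coset" "HOL-Algebra.Bij"
begin

section \<open>The Cayley algebra and its complexification\<close>

text \<open>
  The scalars are a type parameter: the Cayley algebra is \<^typ>\<open>real\<close> \<open>oct\<close>, and its
  complexification is \<^typ>\<open>complex\<close> \<open>oct\<close>. Quaternions are coordinate tuples with respect to
  the basis $1, e_1, e_2, e_3 = e_1 e_2$; the pair \<open>(m, a)\<close> of quaternions is $m + a e_4$.
\<close>

type_synonym 'a quat = "'a \<times> 'a \<times> 'a \<times> 'a"
type_synonym 'a oct = "'a quat \<times> 'a quat"

fun quat_mult :: "'a::comm_ring_1 quat \<Rightarrow> 'a quat \<Rightarrow> 'a quat" where
  "quat_mult (a0, a1, a2, a3) (b0, b1, b2, b3) =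
    (a0 * b0 - a1 * b1 - a2 * b2 - a3 * b3,
     a0 * b1 + a1 * b0 + a2 * b3 - a3 * b2,
     a0 * b2 - a1 * b3 + a2 * b0 + a3 * b1,
     a0 * b3 + a1 * b2 - a2 * b1 + a3 * b0)"

fun quat_cnj :: "'a::comm_ring_1 quat \<Rightarrow> 'a quat" where
  "quat_cnj (a0, a1, a2, a3) = (a0, - a1, - a2, - a3)"

fun oct_mult :: "'a::comm_ring_1 oct \<Rightarrow> 'a oct \<Rightarrow> 'a oct" (infixl "\<odot>" 70) where
  "(m, a) \<odot> (n, b) =
    (quat_mult m n - quat_mult (quat_cnj b) a, quat_mult a (quat_cnj n) + quat_mult b m)"

fun oct_cnj :: "'a::comm_ring_1 oct \<Rightarrow> 'a oct" where
  "oct_cnj (m, a) = (quat_cnj m, - a)"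

fun oct_map :: "('a \<Rightarrow> 'b) \<Rightarrow> 'a oct \<Rightarrow> 'b oct" where
  "oct_map f ((a0, a1, a2, a3), (a4, a5, a6, a7)) =
    ((f a0, f a1, f a2, f a3), (f a4, f a5, f a6, f a7))"

lemma oct_cases:
  obtains a0 a1 a2 a3 a4 a5 a6 a7 where "x = ((a0, a1, a2, a3), (a4, a5, a6, a7))"
  by (rule that [of "fst (fst x)" "fst (snd (fst x))" "fst (snd (snd (fst x)))" "snd (snd (snd (fst x)))"
        "fst (snd x)" "fst (snd (snd x))" "fst (snd (snd (snd x)))" "snd (snd (snd (snd x)))"]) simp

definition oct_scale :: "'a::comm_ring_1 \<Rightarrow> 'a oct \<Rightarrow> 'a oct" where
  "oct_scale c = oct_map ((*) c)"

definition oct_of :: "'a::comm_ring_1 \<Rightarrow> 'a oct" where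
  "oct_of c = ((c, 0, 0, 0), 0)"

definition oct_re :: "'a oct \<Rightarrow> 'a" where
  "oct_re x = fst (fst x)"

definition oct_e1 :: "'a::comm_ring_1 oct" where
  "oct_e1 = ((0, 1, 0, 0), 0)"

fun gamma_oct :: "'a::comm_ring_1 oct \<Rightarrow> 'a oct" where
  "gamma_oct (x, y) = (x, - y)"

text \<open>
  In $a + b e_2$ with $a, b \in \mathbf{R} \oplus \mathbf{R} e_1$, the summand $b e_2$ collects
  the coordinates at $e_2$ and $e_3 = e_1 e_2$.
\<close>

fun gammaH_quat :: "'a::comm_ring_1 quat \<Rightarrow> 'a quat" where
  "gammaH_quat (a0, a1, a2, a3) = (a0, a1, - a2, - a3)"

fun gammaH_oct :: "'a::comm_ring_1 oct \<Rightarrow> 'a oct" where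
  "gammaH_oct (x, y) = (gammaH_quat x, gammaH_quat y)"


section \<open>The exceptional Jordan algebra and its complexification\<close>

type_synonym 'a omat = "'a oct^3^3"

definition omat_map :: "('a oct \<Rightarrow> 'b oct) \<Rightarrow> 'a omat \<Rightarrow> 'b omat" where
  "omat_map f X = (\<chi> i j. f (X $ i $ j))"

definition omat_mult :: "'a::comm_ring_1 omat \<Rightarrow> 'a omat \<Rightarrow> 'a omat" where
  "omat_mult X Y = (\<chi> i j. \<Sum>k\<in>UNIV. X $ i $ k \<odot> Y $ k $ j)"

definition omat_adjoint :: "'a::comm_ring_1 omat \<Rightarrow> 'a omat" where
  "omat_adjoint X = (\<chi> i j. oct_cnj (X $ j $ i))"

definition omat_scale :: "'a::comm_ring_1 \<Rightarrow> 'a omat \<Rightarrow> 'a omat" where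
  "omat_scale c = omat_map (oct_scale c)"

definition omat_one :: "'a::comm_ring_1 omat" where
  "omat_one = (\<chi> i j. if i = j then oct_of 1 else 0)"

definition jordan :: "'a::comm_ring_1 omat set" where
  "jordan = {X. omat_adjoint X = X}"

abbreviation jordanC :: "complex omat set" where
  "jordanC \<equiv> jordan"

text \<open>
  On \<^const>\<open>jordan\<close> the diagonal entries are scalars, so reading off their coordinate at $1$
  loses nothing.
\<close>

definition jtrace :: "'a::comm_ring_1 omat \<Rightarrow> 'a" where
  "jtrace X = (\<Sum>k\<in>UNIV. oct_re (X $ k $ k))"

definition jprod :: "'a::field omat \<Rightarrow> 'a omat \<Rightarrow> 'a omat" where
  "jprod X Y = omat_scale (1/2) (omat_mult X Y + omat_mult Y X)"

definition jform :: "'a::field omat \<Rightarrow> 'a omat \<Rightarrow> 'a" where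
  "jform X Y = jtrace (jprod X Y)"

definition jcross :: "'a::field omat \<Rightarrow> 'a omat \<Rightarrow> 'a omat" where
  "jcross X Y = omat_scale (1/2)
    (omat_scale 2 (jprod X Y) - omat_scale (jtrace X) Y - omat_scale (jtrace Y) X
      + omat_scale (jtrace X * jtrace Y - jform X Y) omat_one)"

definition jdet :: "'a::field omat \<Rightarrow> 'a" where
  "jdet X = 1/3 * jform X (jcross X X)"

definition jtau :: "complex omat \<Rightarrow> complex omat" where
  "jtau = omat_map (oct_map cnj)"

definition jherm :: "complex omat \<Rightarrow> complex omat \<Rightarrow> complex" where
  "jherm X Y = jform (jtau X) Y"

definition complexify :: "real omat \<Rightarrow> complex omat" where
  "complexify = omat_map (oct_map of_real)"

definition jelem ::
  "'a::comm_ring_1 \<Rightarrow> 'a \<Rightarrow> 'a \<Rightarrow> 'a oct \<Rightarrow> 'a oct \<Rightarrow> 'a oct \<Rightarrow> 'a omat" where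
  "jelem \<xi>1 \<xi>2 \<xi>3 x1 x2 x3 = vector
    [vector [oct_of \<xi>1, x3, oct_cnj x2],
     vector [oct_cnj x3, oct_of \<xi>2, x1],
     vector [x2, oct_cnj x1, oct_of \<xi>3]]"

lemma jelem_nth [simp]:
  "jelem \<xi>1 \<xi>2 \<xi>3 x1 x2 x3 $ 1 $ 1 = oct_of \<xi>1" "jelem \<xi>1 \<xi>2 \<xi>3 x1 x2 x3 $ 1 $ 2 = x3"
  "jelem \<xi>1 \<xi>2 \<xi>3 x1 x2 x3 $ 1 $ 3 = oct_cnj x2" "jelem \<xi>1 \<xi>2 \<xi>3 x1 x2 x3 $ 2 $ 1 = oct_cnj x3"
  "jelem \<xi>1 \<xi>2 \<xi>3 x1 x2 x3 $ 2 $ 2 = oct_of \<xi>2" "jelem \<xi>1 \<xi>2 \<xi>3 x1 x2 x3 $ 2 $ 3 = x1"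
  "jelem \<xi>1 \<xi>2 \<xi>3 x1 x2 x3 $ 3 $ 1 = x2" "jelem \<xi>1 \<xi>2 \<xi>3 x1 x2 x3 $ 3 $ 2 = oct_cnj x1"
  "jelem \<xi>1 \<xi>2 \<xi>3 x1 x2 x3 $ 3 $ 3 = oct_of \<xi>3"
  by (simp_all add: jelem_def)

lemma oct_cnj_oct_cnj [simp]: "oct_cnj (oct_cnj x) = x"
  by (cases x rule: oct_cases) simp

lemma oct_re_oct_of [simp]: "oct_re (oct_of c) = c"
  by (simp add: oct_re_def oct_of_def)

lemma oct_cnj_oct_of [simp]: "oct_cnj (oct_of c) = oct_of c"
  by (simp add: oct_of_def zero_prod_def)

lemma jelem_in_jordan: "jelem \<xi>1 \<xi>2 \<xi>3 x1 x2 x3 \<in> jordan"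
  by (simp add: jordan_def omat_adjoint_def vec_eq_iff forall_3)

lemma jordan_eq_jelem:
  fixes X :: "'a::field_char_0 omat"
  assumes "X \<in> jordan"
  shows "X = jelem (oct_re (X $ 1 $ 1)) (oct_re (X $ 2 $ 2)) (oct_re (X $ 3 $ 3))
    (X $ 2 $ 3) (X $ 3 $ 1) (X $ 1 $ 2)"
proof -
  have h: "oct_cnj (X $ j $ i) = X $ i $ j" for i j
    using assms by (simp add: jordan_def omat_adjoint_def vec_eq_iff)
  have n: "- a = a \<longleftrightarrow> a = 0" for a :: 'a
    by (metis add_eq_0_iff mult_2 mult_eq_0_iff zero_neq_numeral)
  have s: "oct_of (oct_re x) = x" if "oct_cnj x = x" for x :: "'a oct"
    using that by (cases x rule: oct_cases)
      (simp add: oct_of_def oct_re_def zero_prod_def n)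
  show ?thesis
    by (simp add: vec_eq_iff forall_3 h s)
qed

lemma oct_of_Re_Im:
  "oct_map of_real (oct_map Re z) + oct_scale \<i> (oct_map of_real (oct_map Im z)) = z"
  by (cases z rule: oct_cases) (simp add: oct_scale_def complex_eq[symmetric])

lemma oct_cnj_Re_Im:
  "oct_cnj (oct_map Re z) = oct_map Re (oct_cnj z)" "oct_cnj (oct_map Im z) = oct_map Im (oct_cnj z)"
  by (cases z rule: oct_cases; simp)+

lemma oct_cnj_complex:
  fixes x y :: "real oct"
  shows "oct_cnj (oct_map of_real x + oct_scale \<i> (oct_map of_real y)) =
    oct_map complex_of_real (oct_cnj x) + oct_scale \<i> (oct_map of_real (oct_cnj y))"
  by (cases x rule: oct_cases; cases y rule: oct_cases) (simp add: oct_scale_def)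

lemma jordan_iff: "X \<in> jordan \<longleftrightarrow> (\<forall>i j. oct_cnj (X $ j $ i) = X $ i $ j)"
  by (simp add: jordan_def omat_adjoint_def vec_eq_iff)

lemma jordanC_complexification:
  "jordanC = {complexify X + omat_scale \<i> (complexify Y) | X Y. X \<in> jordan \<and> Y \<in> jordan}"
    (is "_ = ?R")
proof (rule subset_antisym; rule subsetI)
  fix Z assume Z: "Z \<in> jordanC"
  have "Z = complexify (omat_map (oct_map Re) Z) + omat_scale \<i> (complexify (omat_map (oct_map Im) Z))"
    by (simp add: vec_eq_iff complexify_def omat_map_def omat_scale_def oct_of_Re_Im)
  moreover have "omat_map (oct_map Re) Z \<in> jordan" "omat_map (oct_map Im) Z \<in> jordan"
    using Z by (simp_all add: jordan_iff omat_map_def oct_cnj_Re_Im)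
  ultimately show "Z \<in> ?R"
    by (intro CollectI exI conjI)
next
  fix Z assume "Z \<in> ?R"
  then obtain X Y where "Z = complexify X + omat_scale \<i> (complexify Y)"
    and "X \<in> jordan" "Y \<in> jordan"
    by auto
  then show "Z \<in> jordanC"
    by (simp add: jordan_iff complexify_def omat_map_def omat_scale_def oct_cnj_complex)
qed

lemma jtau_complexify:
  "jtau (complexify X + omat_scale \<i> (complexify Y)) = complexify X - omat_scale \<i> (complexify Y)"
proof -
  have "oct_map cnj (oct_map of_real x + oct_scale \<i> (oct_map of_real y)) =
      oct_map of_real x - oct_scale \<i> (oct_map of_real y)" for x y :: "real oct"
    by (cases x rule: oct_cases; cases y rule: oct_cases) (simp add: oct_scale_def)
  then show ?thesis
    by (simp add: vec_eq_iff complexify_def jtau_def omat_map_def omat_scale_def)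
qed


section \<open>The compact group $E_6$ and the two involutions\<close>

text \<open>
  Elements of $E_6$ are maps on \<^const>\<open>jordanC\<close>, extended by \<^const>\<open>undefined\<close> outside of it;
  \<^term>\<open>BijGroup jordanC\<close> supplies composition and identity.
\<close>

definition IsoC :: "(complex omat \<Rightarrow> complex omat) set" where
  "IsoC = {\<alpha> \<in> Bij jordanC.
    (\<forall>X\<in>jordanC. \<forall>Y\<in>jordanC. \<alpha> (X + Y) = \<alpha> X + \<alpha> Y) \<and>
    (\<forall>c. \<forall>X\<in>jordanC. \<alpha> (omat_scale c X) = omat_scale c (\<alpha> X))}"

definition E6 :: "(complex omat \<Rightarrow> complex omat) monoid" where
  "E6 = (BijGroup jordanC)\<lparr>carrier := {\<alpha> \<in> IsoC.
    (\<forall>X\<in>jordanC. jdet (\<alpha> X) = jdet X) \<and>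
    (\<forall>X\<in>jordanC. \<forall>Y\<in>jordanC. jherm (\<alpha> X) (\<alpha> Y) = jherm X Y)}\<rparr>"

definition gamma :: "complex omat \<Rightarrow> complex omat" where
  "gamma = (\<lambda>X\<in>jordanC. omat_map gamma_oct X)"

definition gammaH :: "complex omat \<Rightarrow> complex omat" where
  "gammaH = (\<lambda>X\<in>jordanC. omat_map gammaH_oct X)"

definition rho2 :: "complex omat \<Rightarrow> complex omat" where
  "rho2 = (\<lambda>X\<in>jordanC. jelem
    (oct_re (X $ 1 $ 1)) (- oct_re (X $ 2 $ 2)) (- oct_re (X $ 3 $ 3))
    (oct_e1 \<odot> X $ 2 $ 3 \<odot> oct_e1)
    (oct_scale \<i> (oct_e1 \<odot> X $ 3 $ 1))
    (oct_scale (- \<i>) (X $ 1 $ 2 \<odot> oct_e1)))"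

lemma rho2_jelem:
  "rho2 (jelem \<xi>1 \<xi>2 \<xi>3 x1 x2 x3) =
    jelem \<xi>1 (- \<xi>2) (- \<xi>3)
      (oct_e1 \<odot> x1 \<odot> oct_e1) (oct_scale \<i> (oct_e1 \<odot> x2)) (oct_scale (- \<i>) (x3 \<odot> oct_e1))"
  by (simp add: rho2_def jelem_in_jordan)

definition gammaH_rho2 :: "complex omat \<Rightarrow> complex omat" where
  "gammaH_rho2 = gammaH \<otimes>\<^bsub>E6\<^esub> rho2"

definition E6_gamma :: "(complex omat \<Rightarrow> complex omat) set" where
  "E6_gamma = {\<alpha> \<in> carrier E6. gamma \<otimes>\<^bsub>E6\<^esub> \<alpha> \<otimes>\<^bsub>E6\<^esub> gamma = \<alpha>}"

definition E6_gammaH_rho2 :: "(complex omat \<Rightarrow> complex omat) set" where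
  "E6_gammaH_rho2 = {\<alpha> \<in> carrier E6.
    gammaH_rho2 \<otimes>\<^bsub>E6\<^esub> \<alpha> \<otimes>\<^bsub>E6\<^esub> inv\<^bsub>E6\<^esub> gammaH_rho2 = \<alpha>}"


section \<open>Unitary groups\<close>

definition U1 :: "complex monoid" where
  "U1 = \<lparr>carrier = {z. cmod z = 1}, mult = (*), one = 1\<rparr>"

definition cadjoint :: "complex^'n^'n \<Rightarrow> complex^'n^'n" where
  "cadjoint A = (\<chi> i j. cnj (A $ j $ i))"

definition SU :: "(complex^'n^'n) monoid" where
  "SU = \<lparr>carrier = {A. cadjoint A ** A = mat 1 \<and> det A = 1}, mult = (**), one = mat 1\<rparr>"

type_synonym u1_u1_su5 = "complex \<times> complex \<times> (complex^5^5)"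

abbreviation U1_U1_SU5 :: "u1_u1_su5 monoid" where
  "U1_U1_SU5 \<equiv> U1 \<times>\<times> U1 \<times>\<times> SU"

definition Z2_sub :: "u1_u1_su5 set" where
  "Z2_sub = {(1, 1, mat 1), (-1, -1, mat 1)}"

definition Z5_sub :: "complex \<Rightarrow> u1_u1_su5 set" where
  "Z5_sub \<nu> = {(1, \<nu> ^ k, mat (\<nu> ^ k)) | k. k \<in> {0, 1, 2, 3, 4}}"


section \<open>Isomorphism of topological groups\<close>

text \<open>
  Groups carry the subspace topology of their ambient type. On function spaces this is the
  topology of pointwise convergence, which on linear maps of the finite-dimensional
  \<^const>\<open>jordanC\<close> is the usual (norm) topology. A factor group carries the quotient topology.
\<close>

definition quotient_group_topology ::
  "('a::topological_space, 'b) monoid_scheme \<Rightarrow> 'a set \<Rightarrow> 'a set topology" where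
  "quotient_group_topology G N = topology (\<lambda>\<U>. \<U> \<subseteq> carrier (G Mod N) \<and>
    openin (top_of_set (carrier G)) {x \<in> carrier G. N #>\<^bsub>G\<^esub> x \<in> \<U>})"

lemma openin_quotient_group_topology:
  "openin (quotient_group_topology G N) \<U> \<longleftrightarrow> \<U> \<subseteq> carrier (G Mod N) \<and>
    openin (top_of_set (carrier G)) {x \<in> carrier G. N #>\<^bsub>G\<^esub> x \<in> \<U>}"
proof -
  have "istopology (\<lambda>\<U>. \<U> \<subseteq> carrier (G Mod N) \<and>
    openin (top_of_set (carrier G)) {x \<in> carrier G. N #>\<^bsub>G\<^esub> x \<in> \<U>})"
    unfolding istopology_def
  proof (intro conjI allI impI, goal_cases)
    case (1 S T)
    then show ?case by (meson inf.coboundedI1)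
  next
    case (2 S T)
    have "{x \<in> carrier G. N #>\<^bsub>G\<^esub> x \<in> S \<inter> T} =
      {x \<in> carrier G. N #>\<^bsub>G\<^esub> x \<in> S} \<inter> {x \<in> carrier G. N #>\<^bsub>G\<^esub> x \<in> T}" by blast
    then show ?case using 2 by (simp add: openin_Int)
  next
    case (3 \<K>)
    then show ?case by (meson Union_least)
  next
    case (4 \<K>)
    have "{x \<in> carrier G. N #>\<^bsub>G\<^esub> x \<in> \<Union>\<K>} = (\<Union>K\<in>\<K>. {x \<in> carrier G. N #>\<^bsub>G\<^esub> x \<in> K})" by blast
    moreover have "openin (top_of_set (carrier G)) (\<Union>K\<in>\<K>. {x \<in> carrier G. N #>\<^bsub>G\<^esub> x \<in> K})"
      by (rule openin_Union) (use 4 in auto)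
    ultimately show ?case by simp
  qed
  then show ?thesis
    unfolding quotient_group_topology_def by (simp add: topology_inverse')
qed

lemma topspace_quotient_group_topology [simp]:
  "topspace (quotient_group_topology G N) = carrier (G Mod N)"
proof
  show "topspace (quotient_group_topology G N) \<subseteq> carrier (G Mod N)"
    using openin_quotient_group_topology openin_topspace by blast
  have "{x \<in> carrier G. N #>\<^bsub>G\<^esub> x \<in> carrier (G Mod N)} = carrier G"
    by (auto simp: FactGroup_def RCOSETS_def)
  then have "openin (quotient_group_topology G N) (carrier (G Mod N))"
    by (simp add: openin_quotient_group_topology)
  then show "carrier (G Mod N) \<subseteq> topspace (quotient_group_topology G N)"
    by (rule openin_subset)
qed

lemma quotient_map_quotient_group_topology:
  "quotient_map (top_of_set (carrier G)) (quotient_group_topology G N) (\<lambda>x. N #>\<^bsub>G\<^esub> x)"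
  unfolding quotient_map_def
  by (auto simp: openin_quotient_group_topology FactGroup_def RCOSETS_def)

definition topological_group_iso ::
  "('a, 'c) monoid_scheme \<Rightarrow> 'a topology \<Rightarrow> ('b, 'd) monoid_scheme \<Rightarrow> 'b topology \<Rightarrow> bool" where
  "topological_group_iso G T H S \<longleftrightarrow> (\<exists>f \<in> iso G H. homeomorphic_map T S f)"

end

(*
Complexified octonion coordinates x_0, ..., x_7 are traded for the null coordinates
x_{2j} + i x_{2j+1}, x_{2j} - i x_{2j+1}. Suitably sorted, the 27 coordinates of an element of the
Jordan algebra become (v, W, s, p, t, q) with v, p, q in C^5, W a skew 5x5 matrix and s, t scalars,
and then
  det = pf(v, W) + s v.q - t v.p + p.(W q),
where pf is the cubic form v wedge W wedge W / 2 in Lambda^5 C^5; the Hermitian form becomes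
standard, gamma changes the signs of s, p, t, q, and gamma_H rho_2 those of W, p, t.

A map commuting with both involutions therefore preserves the blocks v, W, (s, q) and (p, t).
Let A be its unitary action on v. Since s v.q is invariant, the line s and the space q cannot mix,
s is multiplied by some c with |c| = 1, and q by cnj(c) cnj(A); likewise t by d and p by
cnj(d) cnj(A). Then p.(W q) forces W to go to c d A W A^T, and pf forces (c d)^2 det A = 1.
Conversely all such triples (A, c, d) occur. They are parametrised by U(1) x U(1) x SU(5) through
A = w^(-4) cnj(S), c = z w^5, d = z^(-1) w^5, with kernel Z_2 x Z_5. As the source is compact and
the target Hausdorff, the induced bijection of the quotient is a homeomorphism.
*)
theory Submission
  imports Defs
begin

section \<open>The Pfaffian-type cubic form in dimension five\<close>

lemma exhaust_5:
  fixes x :: 5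
  shows "x = 1 \<or> x = 2 \<or> x = 3 \<or> x = 4 \<or> x = 5"
proof (induct x)
  case (of_int z)
  then have "z = 0 \<or> z = 1 \<or> z = 2 \<or> z = 3 \<or> z = 4" by fastforce
  then show ?case by auto
qed

lemma forall_5: "(\<forall>i::5. P i) \<longleftrightarrow> P 1 \<and> P 2 \<and> P 3 \<and> P 4 \<and> P 5"
  by (metis exhaust_5)

lemma UNIV_5: "UNIV = {1, 2, 3, 4, 5::5}"
  using exhaust_5 by auto

lemma sum_5: "sum f (UNIV::5 set) = f 1 + f 2 + f 3 + f 4 + f 5"
  unfolding UNIV_5 by (simp add: ac_simps)

lemma vector_5 [simp]:
  "(vector [a, b, c, d, e] :: 'a::zero^5) $ 1 = a"
  "(vector [a, b, c, d, e] :: 'a^5) $ 2 = b"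
  "(vector [a, b, c, d, e] :: 'a^5) $ 3 = c"
  "(vector [a, b, c, d, e] :: 'a^5) $ 4 = d"
  "(vector [a, b, c, d, e] :: 'a^5) $ 5 = e"
  by (simp_all add: vector_def)

text \<open>
  \<open>pf_polar v W U\<close> is the coefficient of \<open>v \<and> W \<and> U\<close> in the top exterior power, a skew
  matrix \<open>W\<close> standing for the bivector \<open>\<Sum>i<j. W\<^sub>i\<^sub>j e\<^sub>i \<and> e\<^sub>j\<close>.
\<close>

definition pf_polar :: "'a::comm_ring_1^5 \<Rightarrow> 'a^5^5 \<Rightarrow> 'a^5^5 \<Rightarrow> 'a" where
  "pf_polar v W U =
    v$1 * (W$2$3 * U$4$5 + U$2$3 * W$4$5 - W$2$4 * U$3$5 - U$2$4 * W$3$5 + W$2$5 * U$3$4 + U$2$5 * W$3$4)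
  - v$2 * (W$1$3 * U$4$5 + U$1$3 * W$4$5 - W$1$4 * U$3$5 - U$1$4 * W$3$5 + W$1$5 * U$3$4 + U$1$5 * W$3$4)
  + v$3 * (W$1$2 * U$4$5 + U$1$2 * W$4$5 - W$1$4 * U$2$5 - U$1$4 * W$2$5 + W$1$5 * U$2$4 + U$1$5 * W$2$4)
  - v$4 * (W$1$2 * U$3$5 + U$1$2 * W$3$5 - W$1$3 * U$2$5 - U$1$3 * W$2$5 + W$1$5 * U$2$3 + U$1$5 * W$2$3)
  + v$5 * (W$1$2 * U$3$4 + U$1$2 * W$3$4 - W$1$3 * U$2$4 - U$1$3 * W$2$4 + W$1$4 * U$2$3 + U$1$4 * W$2$3)"

definition wedge :: "'a::comm_ring_1^'n \<Rightarrow> 'a^'n \<Rightarrow> 'a^'n^'n" where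
  "wedge a b = (\<chi> i j. a$i * b$j - a$j * b$i)"

text \<open>The wedge product of the five rows is the determinant times the top form, and
  \<open>pf_polar\<close> reads off that coefficient. Through this link multiplicativity of the
  determinant controls \<open>pf_polar\<close> on decomposable bivectors.\<close>

lemma det_5:
  fixes A :: "'a::comm_ring_1^5^5"
  shows "det A = pf_polar (A$1) (wedge (A$2) (A$3)) (wedge (A$4) (A$5))"
proof -
  have f: "finite {2,3,4,5::5}" "1 \<notin> {2,3,4,5::5}" "finite {3,4,5::5}" "2 \<notin> {3,4,5::5}"
    "finite {4,5::5}" "3 \<notin> {4,5::5}" "finite {5::5}" "4 \<notin> {5::5}"
    by auto
  show ?thesis
    \<comment> \<open>The 120 permutations are generated one index at a time, as transpositions
      composed with permutations of the remaining indices.\<close>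
    unfolding det_def UNIV_5
    unfolding sum_over_permutations_insert[OF f(1,2)]
    unfolding sum_over_permutations_insert[OF f(3,4)]
    unfolding sum_over_permutations_insert[OF f(5,6)]
    unfolding sum_over_permutations_insert[OF f(7,8)]
    unfolding permutes_sing
    apply (simp add: sign_swap_id permutation_swap_id permutation_compose sign_compose sign_id swap_id_eq pf_polar_def wedge_def)
    by (simp add: algebra_simps)
qed

abbreviation pf :: "complex^5 \<Rightarrow> complex^5^5 \<Rightarrow> complex" where
  "pf v W \<equiv> pf_polar v W W / 2"

lemma pf_polar_sum_left:
  assumes "finite K"
  shows "pf_polar v (\<chi> i j. \<Sum>k\<in>K. f k * M k $ i $ j) U = (\<Sum>k\<in>K. f k * pf_polar v (M k) U)"
  using assms
proof induction
  case empty
  show ?case by (simp add: pf_polar_def)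
next
  case (insert k K)
  have "pf_polar v (\<chi> i j. \<Sum>k\<in>insert k K. f k * M k $ i $ j) U =
      f k * pf_polar v (M k) U + pf_polar v (\<chi> i j. \<Sum>k\<in>K. f k * M k $ i $ j) U"
    using insert.hyps by (simp add: pf_polar_def algebra_simps)
  with insert show ?case by simp
qed

lemma pf_polar_commute: "pf_polar v W U = pf_polar v U W"
  by (simp add: pf_polar_def algebra_simps)

text \<open>Stacking the five transformed vectors as rows multiplies the matrix of rows by
  \<open>transpose G\<close> on the right, so \<open>det_5\<close> turns the claim into
  multiplicativity of the determinant.\<close>

lemma pf_polar_wedge_transform:
  fixes G :: "complex^5^5"
  shows "pf_polar (G *v v) (wedge (G *v a) (G *v b)) (wedge (G *v c) (G *v d)) =
    det G * pf_polar v (wedge a b) (wedge c d)"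
proof -
  have "det (vector [G *v v, G *v a, G *v b, G *v c, G *v d] :: complex^5^5) =
      det ((vector [v, a, b, c, d] :: complex^5^5) ** transpose G)"
    by (rule arg_cong[where f = det])
      (simp add: vec_eq_iff forall_5 matrix_matrix_mult_def matrix_vector_mult_def transpose_def mult.commute)
  also have "\<dots> = det (vector [v, a, b, c, d] :: complex^5^5) * det G"
    by (simp add: det_mul det_transpose)
  finally show ?thesis
    by (simp add: det_5)
qed

lemma matrix_mult_axis:
  fixes A :: "'a::semiring_1^'n^'m"
  shows "(A *v axis k 1) $ i = A $ i $ k"
  by (simp add: matrix_vector_mult_def axis_def if_distrib cong: if_cong)

lemma skew_matrix_nth:
  fixes W :: "'a::field_char_0^'n^'n"
  assumes "transpose W = - W"
  shows "W $ c $ b = - W $ b $ c" and "W $ b $ b = 0"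
proof -
  show h: "W $ c $ b = - W $ b $ c" for b c
    using arg_cong[OF assms, of "\<lambda>M. M $ b $ c"] by (simp add: transpose_def)
  show "W $ b $ b = 0"
    using h[of b b] by (metis add_eq_0_iff mult_2 mult_eq_0_iff zero_neq_numeral)
qed

text \<open>A skew W is the bivector (1/2) sum over b, c of W_bc e_b wedge e_c, and congruence by G
  replaces each e_b by its image. The factor 1/2 appears because k runs over all ordered pairs.
  \<open>pf_polar_sum_left\<close> can expand this form.\<close>

lemma skew_congruence_wedge:
  fixes G W :: "complex^'n^'n"
  assumes "transpose W = - W"
  shows "G ** W ** transpose G =
    (\<chi> i j. \<Sum>k\<in>UNIV. W $ fst k $ snd k / 2 * wedge (G *v axis (fst k) 1) (G *v axis (snd k) 1) $ i $ j)"
proof -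
  note W = skew_matrix_nth(1)[OF assms]
  have "(G ** W ** transpose G) $ i $ j =
    (\<Sum>k\<in>UNIV. W $ fst k $ snd k / 2 * wedge (G *v axis (fst k) 1) (G *v axis (snd k) 1) $ i $ j)" (is "?L = ?R") for i j
  proof -
    have 1: "?L = (\<Sum>b\<in>UNIV. \<Sum>c\<in>UNIV. W$b$c * (G$i$b * G$j$c))"
      unfolding matrix_matrix_mult_def transpose_def
      by (simp add: sum_distrib_left sum_distrib_right mult_ac) (rule sum.swap)
    \<comment> \<open>Exchanging the roles of b and c and using skewness gives a second expansion;
      the mean of the two is the antisymmetrised sum.\<close>
    have 2: "?L = (\<Sum>b\<in>UNIV. \<Sum>c\<in>UNIV. - W$b$c * (G$j$b * G$i$c))"
    proof -
      have "(\<Sum>b\<in>UNIV. \<Sum>c\<in>UNIV. W$b$c * (G$i$b * G$j$c)) =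
          (\<Sum>c\<in>UNIV. \<Sum>b\<in>UNIV. - W$c$b * (G$j$c * G$i$b))"
        by (subst sum.swap) (rule sum.cong[OF refl] | subst W, simp)+
      then show ?thesis unfolding 1 .
    qed
    have "?R = (\<Sum>b\<in>UNIV. \<Sum>c\<in>UNIV. W$b$c / 2 * (G$i$b * G$j$c - G$j$b * G$i$c))"
      unfolding UNIV_Times_UNIV[symmetric] sum.cartesian_product'
      by (simp add: wedge_def matrix_mult_axis)
    also have "\<dots> = ?L / 2 + ?L / 2"
      apply (subst 1) apply (subst 2)
      by (simp add: sum_divide_distrib sum.distrib[symmetric] algebra_simps diff_divide_distrib)
    finally show ?thesis by simp
  qed
  then show ?thesis
    by (simp add: vec_eq_iff)
qed

text \<open>A skew matrix is a sum of decomposable bivectors and the form is quadratic in W, so the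
  scaling by det G on decomposable bivectors carries over term by term.\<close>

lemma pf_congruence:
  fixes G W :: "complex^5^5"
  assumes "transpose W = - W"
  shows "pf (G *v v) (G ** W ** transpose G) = det G * pf v W"
proof -
  define E where "E H k = wedge (H *v axis (fst k) 1) (H *v axis (snd k) 1)" for H :: "complex^5^5" and k
  have W: "H ** W ** transpose H = (\<chi> i j. \<Sum>k\<in>UNIV. W $ fst k $ snd k / 2 * E H k $ i $ j)" for H
    unfolding E_def by (rule skew_congruence_wedge[OF assms])
  have exp: "pf_polar (H *v v) (H ** W ** transpose H) (H ** W ** transpose H) =
    (\<Sum>k\<in>UNIV. \<Sum>l\<in>UNIV. W $ fst k $ snd k / 2 * (W $ fst l $ snd l / 2 * pf_polar (H *v v) (E H k) (E H l)))" for H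
  proof -
    have "pf_polar (H *v v) (E H k) (H ** W ** transpose H) =
        (\<Sum>l\<in>UNIV. W $ fst l $ snd l / 2 * pf_polar (H *v v) (E H k) (E H l))" for k
      by (subst pf_polar_commute)
        (simp only: W pf_polar_sum_left[OF finite] pf_polar_commute[of _ "E H _" "E H k"])
    then show ?thesis
      by (subst (1) W) (simp only: pf_polar_sum_left[OF finite] sum_distrib_left)
  qed
  have "pf_polar (G *v v) (E G k) (E G l) = det G * pf_polar v (E (mat 1) k) (E (mat 1) l)" for k l
    unfolding E_def by (simp add: pf_polar_wedge_transform)
  \<comment> \<open>The instance H = \<open>mat 1\<close> of the expansion describes pf v W itself,
    so the two double sums are compared termwise.\<close>
  then show ?thesis
    using exp[of G] exp[of "mat 1"] by (simp add: sum_distrib_left mult_ac)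
qed

section \<open>Trace form, cross product and determinant in octonion entries\<close>

fun oct_dot :: "'a::comm_ring_1 oct \<Rightarrow> 'a oct \<Rightarrow> 'a" where
  "oct_dot ((a0, a1, a2, a3), (a4, a5, a6, a7)) ((b0, b1, b2, b3), (b4, b5, b6, b7)) =
    a0 * b0 + a1 * b1 + a2 * b2 + a3 * b3 + a4 * b4 + a5 * b5 + a6 * b6 + a7 * b7"

lemma jform_jelem:
  fixes x1 :: "'a::field_char_0 oct"
  shows "jform (jelem \<xi>1 \<xi>2 \<xi>3 x1 x2 x3) (jelem \<eta>1 \<eta>2 \<eta>3 y1 y2 y3) =
    \<xi>1 * \<eta>1 + \<xi>2 * \<eta>2 + \<xi>3 * \<eta>3 + 2 * (oct_dot x1 y1 + oct_dot x2 y2 + oct_dot x3 y3)"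
proof -
  have r: "oct_re (x + y) = oct_re x + oct_re y" "oct_re (oct_scale c x) = c * oct_re x"
     for c and x y :: "'a oct"
    by (cases x rule: oct_cases; cases y rule: oct_cases; simp add: oct_re_def oct_scale_def)+
  have d: "oct_re (x \<odot> oct_cnj y) = oct_dot x y" "oct_re (oct_cnj x \<odot> y) = oct_dot x y"
    "oct_re (oct_of c \<odot> oct_of d) = c * d" for c d and x y :: "'a oct"
    by (cases x rule: oct_cases; cases y rule: oct_cases; simp add: oct_re_def oct_of_def zero_prod_def algebra_simps)+
  have s: "oct_dot x y = oct_dot y x" for x y :: "'a oct"
    by (cases x rule: oct_cases; cases y rule: oct_cases; simp add: algebra_simps)
  show ?thesis
    by (simp add: jform_def jprod_def jtrace_def omat_mult_def omat_scale_def omat_map_def sum_3 r d s)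
      (simp add: field_simps)
qed

lemma jcross_jelem:
  fixes x1 :: "'a::field_char_0 oct"
  shows "jcross (jelem \<xi>1 \<xi>2 \<xi>3 x1 x2 x3) (jelem \<xi>1 \<xi>2 \<xi>3 x1 x2 x3) =
    jelem (\<xi>2 * \<xi>3 - oct_dot x1 x1) (\<xi>3 * \<xi>1 - oct_dot x2 x2) (\<xi>1 * \<xi>2 - oct_dot x3 x3)
      (oct_cnj (x2 \<odot> x3) - oct_scale \<xi>1 x1) (oct_cnj (x3 \<odot> x1) - oct_scale \<xi>2 x2)
      (oct_cnj (x1 \<odot> x2) - oct_scale \<xi>3 x3)"
  unfolding jcross_def jform_jelem
  apply (cases x1 rule: oct_cases; cases x2 rule: oct_cases; cases x3 rule: oct_cases)
  apply (simp add: vec_eq_iff forall_3 jprod_def jtrace_def omat_mult_def omat_scale_def omat_map_def sum_3 omat_one_def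
     oct_re_def oct_of_def oct_scale_def zero_prod_def)
  by (simp add: field_simps)

lemma jdet_jelem:
  fixes x1 :: "'a::field_char_0 oct"
  shows "jdet (jelem \<xi>1 \<xi>2 \<xi>3 x1 x2 x3) =
    \<xi>1 * \<xi>2 * \<xi>3 + 2 * oct_re (x1 \<odot> x2 \<odot> x3)
      - \<xi>1 * oct_dot x1 x1 - \<xi>2 * oct_dot x2 x2 - \<xi>3 * oct_dot x3 x3"
  unfolding jdet_def jcross_jelem jform_jelem
  apply (cases x1 rule: oct_cases; cases x2 rule: oct_cases; cases x3 rule: oct_cases)
  apply (simp add: oct_re_def oct_of_def oct_scale_def zero_prod_def)
  by (simp add: field_simps)

section \<open>Null coordinates\<close>

definition null_oct ::
  "complex \<Rightarrow> complex \<Rightarrow> complex \<Rightarrow> complex \<Rightarrow> complex \<Rightarrow> complex \<Rightarrow> complex \<Rightarrow> complex \<Rightarrow> complex oct" where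
  "null_oct u0 w0 u1 w1 u2 w2 u3 w3 =
    (((u0 + w0) / 2, \<i> * (w0 - u0) / 2, (u1 + w1) / 2, \<i> * (w1 - u1) / 2),
     ((u2 + w2) / 2, \<i> * (w2 - u2) / 2, (u3 + w3) / 2, \<i> * (w3 - u3) / 2))"

definition pair_dot :: "'a::comm_ring_1^'n \<Rightarrow> 'a^'n \<Rightarrow> 'a" where
  "pair_dot p q = (\<Sum>i\<in>UNIV. p $ i * q $ i)"

text \<open>
  The entries of \<open>null_oct\<close> are ordered so that \<open>u\<^sub>j\<close>, \<open>w\<^sub>j\<close> are the values of
  \<open>x\<^sub>2\<^sub>j + \<i> x\<^sub>2\<^sub>j\<^sub>+\<^sub>1\<close> and \<open>x\<^sub>2\<^sub>j - \<i> x\<^sub>2\<^sub>j\<^sub>+\<^sub>1\<close>. The placement of the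
  coordinates in \<open>jmk\<close> sorts joint eigenvectors of $\gamma$ and $\gamma_H\rho_2$; only the entries
  of \<open>W\<close> above the diagonal are used, so \<open>W\<close> can be recovered only when it is skew.
\<close>

definition jmk :: "complex^5 \<Rightarrow> complex^5^5 \<Rightarrow> complex \<Rightarrow> complex^5 \<Rightarrow> complex \<Rightarrow> complex^5 \<Rightarrow> complex omat" where
  "jmk v W s p t q = jelem (v$1) (W$4$5) (W$2$3)
    (null_oct (- W$2$5) (W$3$4) (- W$3$5) (- W$2$4) s (- q$1) (p$1) t)
    (null_oct (W$1$3) (v$2) (- v$3) (W$1$2) (p$5) (q$4) (- p$4) (q$5))
    (null_oct (- v$4) (- W$1$5) (- v$5) (W$1$4) (- p$3) (- q$2) (p$2) (- q$3))"

text \<open>Together with \<open>oct_w\<close> this inverts \<open>null_oct\<close>; the index k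
  stands for the coordinates 2k and 2k+1, and any index above 2 is read as 3.\<close>

fun oct_u :: "complex oct \<Rightarrow> nat \<Rightarrow> complex" where
  "oct_u ((a0, a1, a2, a3), (a4, a5, a6, a7)) k =
    (if k = 0 then a0 + \<i> * a1 else if k = 1 then a2 + \<i> * a3 else if k = 2 then a4 + \<i> * a5 else a6 + \<i> * a7)"

fun oct_w :: "complex oct \<Rightarrow> nat \<Rightarrow> complex" where
  "oct_w ((a0, a1, a2, a3), (a4, a5, a6, a7)) k =
    (if k = 0 then a0 - \<i> * a1 else if k = 1 then a2 - \<i> * a3 else if k = 2 then a4 - \<i> * a5 else a6 - \<i> * a7)"

definition coord_v :: "complex omat \<Rightarrow> complex^5" where
  "coord_v X = vector [oct_re (X$1$1), oct_w (X$3$1) 0, - oct_u (X$3$1) 1, - oct_u (X$1$2) 0, - oct_u (X$1$2) 1]"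

definition skew5 :: "'a::comm_ring_1 \<Rightarrow> 'a \<Rightarrow> 'a \<Rightarrow> 'a \<Rightarrow> 'a \<Rightarrow> 'a \<Rightarrow> 'a \<Rightarrow> 'a \<Rightarrow> 'a \<Rightarrow> 'a \<Rightarrow> 'a^5^5" where
  "skew5 a12 a13 a14 a15 a23 a24 a25 a34 a35 a45 = vector
    [vector [0, a12, a13, a14, a15],
     vector [- a12, 0, a23, a24, a25],
     vector [- a13, - a23, 0, a34, a35],
     vector [- a14, - a24, - a34, 0, a45],
     vector [- a15, - a25, - a35, - a45, 0]]"

text \<open>Built from \<open>skew5\<close>, so the result is skew for every X; with
  \<open>jmk_coord\<close> each element of the Jordan algebra is thus described by a skew W.\<close>

definition coord_W :: "complex omat \<Rightarrow> complex^5^5" where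
  "coord_W X = skew5 (oct_w (X$3$1) 1) (oct_u (X$3$1) 0) (oct_w (X$1$2) 1) (- oct_w (X$1$2) 0)
    (oct_re (X$3$3)) (- oct_w (X$2$3) 1) (- oct_u (X$2$3) 0) (oct_w (X$2$3) 0) (- oct_u (X$2$3) 1)
    (oct_re (X$2$2))"

definition coord_s :: "complex omat \<Rightarrow> complex" where "coord_s X = oct_u (X$2$3) 2"

definition coord_t :: "complex omat \<Rightarrow> complex" where "coord_t X = oct_w (X$2$3) 3"

definition coord_p :: "complex omat \<Rightarrow> complex^5" where
  "coord_p X = vector [oct_u (X$2$3) 3, oct_u (X$1$2) 3, - oct_u (X$1$2) 2, - oct_u (X$3$1) 3, oct_u (X$3$1) 2]"

definition coord_q :: "complex omat \<Rightarrow> complex^5" where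
  "coord_q X = vector [- oct_w (X$2$3) 2, - oct_w (X$1$2) 2, - oct_w (X$1$2) 3, oct_w (X$3$1) 2, oct_w (X$3$1) 3]"

lemma oct_u_null_oct [simp]:
  "oct_u (null_oct u0 w0 u1 w1 u2 w2 u3 w3) k = (if k = 0 then u0 else if k = 1 then u1 else if k = 2 then u2 else u3)"
  "oct_w (null_oct u0 w0 u1 w1 u2 w2 u3 w3) k = (if k = 0 then w0 else if k = 1 then w1 else if k = 2 then w2 else w3)"
  by (simp_all add: null_oct_def field_simps)

lemma skew_entries:
  fixes W :: "'a::field_char_0^5^5"
  assumes "transpose W = - W"
  shows "skew5 (W$1$2) (W$1$3) (W$1$4) (W$1$5) (W$2$3) (W$2$4) (W$2$5) (W$3$4) (W$3$5) (W$4$5) = W"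
proof -
  have h: "W $ c $ b = - W $ b $ c" for b c
    by (rule skew_matrix_nth(1)[OF assms])
  note n = skew_matrix_nth(2)[OF assms]
  show ?thesis
    by (simp add: vec_eq_iff forall_5 skew5_def n h[of 1 2] h[of 1 3] h[of 1 4] h[of 1 5]
        h[of 2 3] h[of 2 4] h[of 2 5] h[of 3 4] h[of 3 5] h[of 4 5])
qed

lemma transpose_coord_W [simp]: "transpose (coord_W X) = - coord_W X"
  by (simp add: vec_eq_iff forall_5 coord_W_def skew5_def transpose_def)

lemma jmk_in_jordan [simp]: "jmk v W s p t q \<in> jordan"
  by (simp add: jmk_def jelem_in_jordan)

lemma coord_jmk:
  "coord_v (jmk v W s p t q) = v" "coord_s (jmk v W s p t q) = s" "coord_p (jmk v W s p t q) = p"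
  "coord_t (jmk v W s p t q) = t" "coord_q (jmk v W s p t q) = q"
  "transpose W = - W \<Longrightarrow> coord_W (jmk v W s p t q) = W"
proof -
  show "coord_v (jmk v W s p t q) = v" "coord_s (jmk v W s p t q) = s" "coord_p (jmk v W s p t q) = p"
  "coord_t (jmk v W s p t q) = t" "coord_q (jmk v W s p t q) = q"
    by (simp_all add: vec_eq_iff forall_5 jmk_def coord_v_def coord_s_def coord_p_def coord_t_def coord_q_def)
  assume "transpose W = - W"
  from skew_entries[OF this] show "coord_W (jmk v W s p t q) = W"
    by (simp add: jmk_def coord_W_def)
qed

lemma jmk_coord:
  assumes "X \<in> jordan"
  shows "jmk (coord_v X) (coord_W X) (coord_s X) (coord_p X) (coord_t X) (coord_q X) = X"
proof -
  have n: "null_oct (oct_u x 0) (oct_w x 0) (oct_u x 1) (oct_w x 1) (oct_u x 2) (oct_w x 2) (oct_u x 3) (oct_w x 3) = x" for x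
    by (cases x rule: oct_cases) (simp add: null_oct_def field_simps)
  show ?thesis
    using jordan_eq_jelem[OF assms]
    by (simp add: jmk_def coord_v_def coord_s_def coord_p_def coord_t_def coord_q_def coord_W_def skew5_def n[simplified])
qed

section \<open>Linear structure, determinant and Hermitian form in null coordinates\<close>

lemma null_oct_add:
  "null_oct u0 w0 u1 w1 u2 w2 u3 w3 + null_oct u0' w0' u1' w1' u2' w2' u3' w3' =
    null_oct (u0 + u0') (w0 + w0') (u1 + u1') (w1 + w1') (u2 + u2') (w2 + w2') (u3 + u3') (w3 + w3')"
  by (simp add: null_oct_def field_simps)

lemma null_oct_scale:
  "oct_scale c (null_oct u0 w0 u1 w1 u2 w2 u3 w3) =
    null_oct (c * u0) (c * w0) (c * u1) (c * w1) (c * u2) (c * w2) (c * u3) (c * w3)"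
  by (simp add: null_oct_def oct_scale_def field_simps)

lemma jelem_add:
  "jelem a1 a2 a3 x1 x2 x3 + jelem b1 b2 b3 y1 y2 y3 = jelem (a1 + b1) (a2 + b2) (a3 + b3) (x1 + y1) (x2 + y2) (x3 + y3)"
proof -
  have "oct_cnj (x + y) = oct_cnj x + oct_cnj y" for x y :: "'a oct"
    by (cases x rule: oct_cases; cases y rule: oct_cases) simp
  then show ?thesis
    by (simp add: vec_eq_iff forall_3 oct_of_def zero_prod_def)
qed

lemma jelem_scale:
  "omat_scale c (jelem a1 a2 a3 x1 x2 x3) = jelem (c * a1) (c * a2) (c * a3) (oct_scale c x1) (oct_scale c x2) (oct_scale c x3)"
proof -
  have "oct_cnj (oct_scale c x) = oct_scale c (oct_cnj x)" for x :: "'a oct"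
    by (cases x rule: oct_cases) (simp add: oct_scale_def)
  then show ?thesis
    by (simp add: vec_eq_iff forall_3 omat_scale_def omat_map_def) (simp add: oct_of_def zero_prod_def oct_scale_def)
qed

lemma jmk_add:
  "jmk v W s p t q + jmk v' W' s' p' t' q' = jmk (v + v') (W + W') (s + s') (p + p') (t + t') (q + q')"
  by (simp add: jmk_def jelem_add null_oct_add)

lemma jmk_scale:
  "omat_scale c (jmk v W s p t q) = jmk (c *s v) (\<chi> i. c *s W $ i) (c * s) (c *s p) (c * t) (c *s q)"
  by (simp add: jmk_def jelem_scale null_oct_scale)

lemma null_oct_mult:
  "null_oct u0 w0 u1 w1 u2 w2 u3 w3 \<odot> null_oct u0' w0' u1' w1' u2' w2' u3' w3' = null_oct
    (u0 * u0' - u1 * w1' - u2 * w2' - w3 * u3') (w0 * w0' - w1 * u1' - w2 * u2' - u3 * w3')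
    (u0 * u1' + u1 * w0' - u3 * w2' + w2 * u3') (w0 * w1' + w1 * u0' - w3 * u2' + u2 * w3')
    (u2 * w0' + u3 * w1' + u0 * u2' - w1 * u3') (w2 * u0' + w3 * u1' + w0 * w2' - u1 * w3')
    (u3 * u0' - u2 * u1' + u1 * u2' + w0 * u3') (w3 * w0' - w2 * w1' + w1 * w2' + u0 * w3')"
  by (simp add: null_oct_def) (simp add: field_simps)

lemma oct_dot_null_oct:
  "oct_dot (null_oct u0 w0 u1 w1 u2 w2 u3 w3) (null_oct u0' w0' u1' w1' u2' w2' u3' w3') =
    (u0 * w0' + w0 * u0' + u1 * w1' + w1 * u1' + u2 * w2' + w2 * u2' + u3 * w3' + w3 * u3') / 2"
  by (simp add: null_oct_def) (simp add: field_simps)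

text \<open>The signs in \<open>jmk\<close> are arranged for this formula. The last three terms pair
  (p, s) with (q, t) through the 6x6 skew matrix with blocks W, -v, v^T, 0, whose Pfaffian is pf v W
  up to sign.\<close>

lemma jdet_jmk:
  assumes "transpose W = - W"
  shows "jdet (jmk v W s p t q) = pf v W + s * pair_dot v q - t * pair_dot v p + pair_dot p (W *v q)"
proof -
  have h: "W $ c $ b = - W $ b $ c" for b c
    by (rule skew_matrix_nth(1)[OF assms])
  note n = skew_matrix_nth(2)[OF assms]
  have r: "2 * oct_re (null_oct u0 w0 u1 w1 u2 w2 u3 w3) = u0 + w0" for u0 w0 u1 w1 u2 w2 u3 w3
    by (simp add: null_oct_def oct_re_def)
  note hs = h[of 1 2] h[of 1 3] h[of 1 4] h[of 1 5] h[of 2 3] h[of 2 4] h[of 2 5] h[of 3 4] h[of 3 5] h[of 4 5]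
  show ?thesis
    unfolding jmk_def jdet_jelem pair_dot_def pf_polar_def sum_5 matrix_vector_mult_def null_oct_mult oct_dot_null_oct r
    by (simp add: sum_5 n hs) (simp add: field_simps)
qed

definition herm :: "complex^'n \<Rightarrow> complex^'n \<Rightarrow> complex" where
  "herm v w = (\<Sum>i\<in>UNIV. cnj (v $ i) * w $ i)"

text \<open>The factor 1/2 compensates that each entry of W above the diagonal is repeated below it,
  whereas \<open>jmk\<close> stores it once.\<close>

lemma jherm_jmk:
  assumes "transpose W = - W" "transpose W' = - W'"
  shows "jherm (jmk v W s p t q) (jmk v' W' s' p' t' q') =
    herm v v' + (\<Sum>i\<in>UNIV. herm (W $ i) (W' $ i)) / 2 + cnj s * s' + herm p p' + cnj t * t' + herm q q'"
proof -
  have jt: "jtau (jelem a1 a2 a3 x1 x2 x3) =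
      jelem (cnj a1) (cnj a2) (cnj a3) (oct_map cnj x1) (oct_map cnj x2) (oct_map cnj x3)" for a1 a2 a3 x1 x2 x3
  proof -
    have "oct_map cnj (oct_cnj x) = oct_cnj (oct_map cnj x)" for x
      by (cases x rule: oct_cases) simp
    then show ?thesis
      by (simp add: vec_eq_iff forall_3 jtau_def omat_map_def) (simp add: oct_of_def zero_prod_def)
  qed
  \<comment> \<open>Complex conjugation interchanges the u and w coordinates while conjugating them.
    As \<open>oct_dot\<close> pairs u with w, the Hermitian form becomes diagonal.\<close>
  have tn: "oct_map cnj (null_oct u0 w0 u1 w1 u2 w2 u3 w3) =
      null_oct (cnj w0) (cnj u0) (cnj w1) (cnj u1) (cnj w2) (cnj u2) (cnj w3) (cnj u3)" for u0 w0 u1 w1 u2 w2 u3 w3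
    by (simp add: null_oct_def) (simp add: field_simps)
  have h: "W $ c $ b = - W $ b $ c" "W' $ c $ b = - W' $ b $ c" for b c
    by (rule skew_matrix_nth(1)[OF assms(1)], rule skew_matrix_nth(1)[OF assms(2)])
  note n = skew_matrix_nth(2)[OF assms(1)] skew_matrix_nth(2)[OF assms(2)]
  note hs = h[of 1 2] h[of 1 3] h[of 1 4] h[of 1 5] h[of 2 3] h[of 2 4] h[of 2 5] h[of 3 4] h[of 3 5] h[of 4 5]
  show ?thesis
    unfolding jherm_def jmk_def jt tn jform_jelem oct_dot_null_oct herm_def sum_5
    by (simp add: n hs) (simp add: field_simps)
qed

section \<open>The two involutions in null coordinates\<close>

lemma gamma_jmk: "gamma (jmk v W s p t q) = jmk v W (- s) (- p) (- t) (- q)"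
proof -
  have "gamma_oct (oct_cnj x) = oct_cnj (gamma_oct x)" for x :: "complex oct"
    by (cases x rule: oct_cases) simp
  then have j: "gamma (jelem a1 a2 a3 x1 x2 x3) = jelem a1 a2 a3 (gamma_oct x1) (gamma_oct x2) (gamma_oct x3)"
    for a1 a2 a3 x1 x2 x3
    by (simp add: gamma_def jelem_in_jordan vec_eq_iff forall_3 omat_map_def) (simp add: oct_of_def)
  have "gamma_oct (null_oct u0 w0 u1 w1 u2 w2 u3 w3) = null_oct u0 w0 u1 w1 (- u2) (- w2) (- u3) (- w3)"
    for u0 w0 u1 w1 u2 w2 u3 w3
    by (simp add: null_oct_def) (simp add: field_simps)
  then show ?thesis
    unfolding jmk_def j by simp
qed

lemma gammaH_jelem:
  "gammaH (jelem a1 a2 a3 x1 x2 x3) = jelem a1 a2 a3 (gammaH_oct x1) (gammaH_oct x2) (gammaH_oct x3)"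
proof -
  have "gammaH_oct (oct_cnj x) = oct_cnj (gammaH_oct x)" for x :: "complex oct"
    by (cases x rule: oct_cases) simp
  then show ?thesis
    by (simp add: gammaH_def jelem_in_jordan vec_eq_iff forall_3 omat_map_def) (simp add: oct_of_def zero_prod_def)
qed

text \<open>Left and right multiplication by e_1 are diagonal in null coordinates, with eigenvalues
  i and -i, so \<open>rho2\<close> and \<open>gammaH\<close> only change signs.\<close>

lemma gammaH_rho2_apply_jmk: "gammaH (rho2 (jmk v W s p t q)) = jmk v (- W) s (- p) (- t) q"
proof -
  have ii: "\<i> * x * \<i> = - x" "\<i> * (x * \<i>) = - x" for x
    by (simp_all add: algebra_simps)
  have e: "oct_e1 = null_oct \<i> (- \<i>) 0 0 0 0 0 0"
    by (simp add: oct_e1_def null_oct_def zero_prod_def)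
  have "gammaH_oct (null_oct u0 w0 u1 w1 u2 w2 u3 w3) = null_oct u0 w0 (- u1) (- w1) u2 w2 (- u3) (- w3)"
    for u0 w0 u1 w1 u2 w2 u3 w3
    by (simp add: null_oct_def) (simp add: field_simps)
  then show ?thesis
    unfolding jmk_def rho2_jelem gammaH_jelem e null_oct_mult null_oct_scale
    using ii by simp
qed

section \<open>The involutions and their common centralizer\<close>

lemma Bij_involution:
  assumes "f \<in> extensional S" "\<And>x. x \<in> S \<Longrightarrow> f x \<in> S" "\<And>x. x \<in> S \<Longrightarrow> f (f x) = x"
  shows "f \<in> Bij S"
proof -
  have "bij_betw f S S"
    by (rule bij_betw_byWitness[where f' = f]) (use assms in auto)
  with assms(1) show ?thesis by (simp add: Bij_def)
qed

text \<open>Multiplication in \<open>BijGroup\<close> is restricted to bijections, so both factors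
  must be known to be such before the product \<open>gammaH_rho2\<close> can be evaluated.\<close>

lemma gammaH_Bij: "gammaH \<in> Bij jordanC"
proof (rule Bij_involution)
  show "gammaH \<in> extensional jordanC" by (simp add: gammaH_def)
next
  fix X :: "complex omat" assume X: "X \<in> jordan"
  show "gammaH X \<in> jordan"
    by (subst jordan_eq_jelem[OF X]) (simp add: gammaH_jelem jelem_in_jordan)
  have "gammaH_oct (gammaH_oct x) = x" for x :: "complex oct"
    by (cases x rule: oct_cases) simp
  then show "gammaH (gammaH X) = X"
    by (subst (1 2) jordan_eq_jelem[OF X]) (simp add: gammaH_jelem)
qed

lemma rho2_Bij: "rho2 \<in> Bij jordanC"
proof (rule Bij_involution)
  show "rho2 \<in> extensional jordanC" by (simp add: rho2_def)
next
  fix X :: "complex omat" assume X: "X \<in> jordan"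
  show "rho2 X \<in> jordan"
    by (subst jordan_eq_jelem[OF X]) (simp add: rho2_jelem jelem_in_jordan)
  have "oct_e1 \<odot> (oct_e1 \<odot> x \<odot> oct_e1) \<odot> oct_e1 = x"
      "oct_scale \<i> (oct_e1 \<odot> oct_scale \<i> (oct_e1 \<odot> x)) = x"
      "oct_scale (- \<i>) (oct_scale (- \<i>) (x \<odot> oct_e1) \<odot> oct_e1) = x" for x
    by (cases x rule: oct_cases; simp add: oct_e1_def oct_scale_def zero_prod_def)+
  then show "rho2 (rho2 X) = X"
    by (subst (1 2) jordan_eq_jelem[OF X]) (simp add: rho2_jelem)
qed

lemma mult_E6 [simp]: "f \<otimes>\<^bsub>E6\<^esub> g = f \<otimes>\<^bsub>BijGroup jordanC\<^esub> g"
  and one_E6 [simp]: "\<one>\<^bsub>E6\<^esub> = \<one>\<^bsub>BijGroup jordanC\<^esub>"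
  by (simp_all add: E6_def)

lemma gammaH_rho2_jmk: "gammaH_rho2 (jmk v W s p t q) = jmk v (- W) s (- p) (- t) q"
  by (simp add: gammaH_rho2_def BijGroup_def gammaH_Bij rho2_Bij compose_def gammaH_rho2_apply_jmk)

lemma gammaH_rho2_extensional: "gammaH_rho2 \<in> extensional jordanC"
  by (simp add: gammaH_rho2_def BijGroup_def gammaH_Bij rho2_Bij)

lemma jordan_jmk_cases:
  assumes "X \<in> jordanC"
  obtains v W s p t q where "X = jmk v W s p t q" "transpose W = - W"
  using jmk_coord[OF assms] transpose_coord_W by metis

lemma E6I:
  assumes "f \<in> Bij jordanC"
    "\<And>X Y. X \<in> jordan \<Longrightarrow> Y \<in> jordan \<Longrightarrow> f (X + Y) = f X + f Y"
    "\<And>c X. X \<in> jordan \<Longrightarrow> f (omat_scale c X) = omat_scale c (f X)"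
    "\<And>X. X \<in> jordan \<Longrightarrow> jdet (f X) = jdet X"
    "\<And>X Y. X \<in> jordan \<Longrightarrow> Y \<in> jordan \<Longrightarrow> jherm (f X) (f Y) = jherm X Y"
  shows "f \<in> carrier E6"
  using assms by (simp add: E6_def IsoC_def)

lemma transpose_uminus: "transpose (- A) = - transpose A"
  by (simp add: transpose_def vec_eq_iff)

lemma gammaH_rho2_E6: "gammaH_rho2 \<in> carrier E6"
proof (rule E6I)
  show "gammaH_rho2 \<in> Bij jordanC"
    by (rule Bij_involution[OF gammaH_rho2_extensional]; elim jordan_jmk_cases; simp add: gammaH_rho2_jmk)
next
  fix c and X :: "complex omat" assume "X \<in> jordan"
  moreover have "(\<chi> i. - (c *s W $ i)) = - (\<chi> i. c *s W $ i)" for W :: "complex^5^5"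
    by (simp add: vec_eq_iff)
  ultimately show "gammaH_rho2 (omat_scale c X) = omat_scale c (gammaH_rho2 X)"
    by (elim jordan_jmk_cases) (simp add: gammaH_rho2_jmk jmk_scale)
next
  fix X :: "complex omat" assume "X \<in> jordan"
  then show "jdet (gammaH_rho2 X) = jdet X"
    by (elim jordan_jmk_cases)
      (simp add: gammaH_rho2_jmk jdet_jmk transpose_uminus pf_polar_def pair_dot_def matrix_vector_mult_def sum_negf)
qed (elim jordan_jmk_cases; simp add: gammaH_rho2_jmk jmk_add jherm_jmk transpose_uminus herm_def sum_negf)+

lemma gamma_E6: "gamma \<in> carrier E6"
proof (rule E6I)
  show "gamma \<in> Bij jordanC"
  proof (rule Bij_involution)
    show "gamma \<in> extensional jordanC" by (simp add: gamma_def)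
  qed (elim jordan_jmk_cases; simp add: gamma_jmk)+
qed (elim jordan_jmk_cases; simp add: gamma_jmk jmk_add jmk_scale jdet_jmk jherm_jmk pair_dot_def
    matrix_vector_mult_def herm_def sum_negf)+

lemma E6_Bij: "f \<in> carrier E6 \<Longrightarrow> f \<in> Bij jordanC"
  by (simp add: E6_def IsoC_def)

lemma E6_closed: "f \<in> carrier E6 \<Longrightarrow> X \<in> jordan \<Longrightarrow> f X \<in> jordan"
  using Bij_imp_funcset[OF E6_Bij] by blast

text \<open>Both sides of the first equation are \<open>undefined\<close> outside
  \<open>jordan\<close>, so only values on \<open>jordan\<close> matter; there one factor g is moved
  across by g (g X) = X.\<close>

lemma involution_conjugation_iff:
  assumes g: "g \<in> carrier E6" "\<And>X. X \<in> jordan \<Longrightarrow> g (g X) = X" and f: "f \<in> carrier E6"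
  shows "g \<otimes>\<^bsub>E6\<^esub> f \<otimes>\<^bsub>E6\<^esub> g = f \<longleftrightarrow> (\<forall>X\<in>jordan. f (g X) = g (f X))"
proof -
  have eq: "g \<otimes>\<^bsub>E6\<^esub> f \<otimes>\<^bsub>E6\<^esub> g = compose jordan (compose jordan g f) g"
    using g(1) f by (simp add: BijGroup_def E6_Bij compose_Bij)
  have "compose jordan (compose jordan g f) g = f \<longleftrightarrow> (\<forall>X\<in>jordan. g (f (g X)) = f X)"
  proof
    assume "compose jordan (compose jordan g f) g = f"
    then show "\<forall>X\<in>jordan. g (f (g X)) = f X"
      using g(1) by (auto simp: compose_def fun_eq_iff E6_closed split: if_splits)
  next
    assume "\<forall>X\<in>jordan. g (f (g X)) = f X"
    then show "compose jordan (compose jordan g f) g = f"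
      using Bij_imp_extensional[OF E6_Bij[OF f]] g(1)
      by (auto simp: compose_def fun_eq_iff E6_closed extensional_def)
  qed
  also have "\<dots> \<longleftrightarrow> (\<forall>X\<in>jordan. f (g X) = g (f X))"
    using g f by (metis E6_closed)
  finally show ?thesis unfolding eq .
qed

text \<open>The inverse is the definite description of \<open>m_inv_def\<close>. Its uniqueness is
  imported from the ambient group \<open>BijGroup jordanC\<close>, which has the same product and
  unit.\<close>

lemma involution_inv_E6:
  assumes g: "g \<in> carrier E6" "\<And>X. X \<in> jordan \<Longrightarrow> g (g X) = X"
  shows "inv\<^bsub>E6\<^esub> g = g"
proof -
  interpret B: group "BijGroup jordanC" by (rule group_BijGroup)
  have B: "h \<in> carrier (BijGroup jordanC)" if "h \<in> carrier E6" for h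
    using that by (simp add: BijGroup_def E6_Bij)
  have gg: "g \<otimes>\<^bsub>BijGroup jordanC\<^esub> g = \<one>\<^bsub>BijGroup jordanC\<^esub>"
    using g by (auto simp: BijGroup_def E6_Bij compose_def fun_eq_iff)
  show ?thesis
    unfolding m_inv_def
  proof (rule the_equality)
    fix y assume "y \<in> carrier E6 \<and> g \<otimes>\<^bsub>E6\<^esub> y = \<one>\<^bsub>E6\<^esub> \<and> y \<otimes>\<^bsub>E6\<^esub> g = \<one>\<^bsub>E6\<^esub>"
    then show "y = g"
      using gg B g(1) by (metis B.inv_equality mult_E6 one_E6)
  qed (use g gg in simp)
qed

lemma fixed_group_iff:
  "f \<in> E6_gamma \<inter> E6_gammaH_rho2 \<longleftrightarrow> f \<in> carrier E6 \<and>
    (\<forall>X\<in>jordan. f (gamma X) = gamma (f X) \<and> f (gammaH_rho2 X) = gammaH_rho2 (f X))"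
proof -
  have g: "gamma (gamma X) = X" "gammaH_rho2 (gammaH_rho2 X) = X" if "X \<in> jordan" for X
    using that by (elim jordan_jmk_cases; simp add: gamma_jmk gammaH_rho2_jmk)+
  have "f \<in> E6_gamma \<inter> E6_gammaH_rho2 \<longleftrightarrow> f \<in> carrier E6 \<and>
     gamma \<otimes>\<^bsub>E6\<^esub> f \<otimes>\<^bsub>E6\<^esub> gamma = f \<and> gammaH_rho2 \<otimes>\<^bsub>E6\<^esub> f \<otimes>\<^bsub>E6\<^esub> gammaH_rho2 = f"
    using involution_inv_E6[OF gammaH_rho2_E6 g(2)] by (auto simp: E6_gamma_def E6_gammaH_rho2_def)
  then show ?thesis
    using involution_conjugation_iff[OF gamma_E6 g(1)] involution_conjugation_iff[OF gammaH_rho2_E6 g(2)] by auto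
qed

section \<open>The block maps\<close>

definition cnj_mat :: "complex^'n^'m \<Rightarrow> complex^'n^'m" where
  "cnj_mat A = (\<chi> i j. cnj (A $ i $ j))"

definition scale_mat :: "'a::times \<Rightarrow> 'a^'n^'m \<Rightarrow> 'a^'n^'m" where
  "scale_mat k M = (\<chi> i j. k * M $ i $ j)"

lemma scale_mat_nth [simp]: "scale_mat k M $ i $ j = k * M $ i $ j"
  by (simp add: scale_mat_def)

lemma cnj_mat_nth [simp]: "cnj_mat A $ i $ j = cnj (A $ i $ j)"
  by (simp add: cnj_mat_def)

lemma cadjoint_nth [simp]: "cadjoint A $ i $ j = cnj (A $ j $ i)"
  by (simp add: cadjoint_def)

lemma transpose_nth [simp]: "transpose A $ i $ j = A $ j $ i"
  by (simp add: transpose_def)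

lemma cadjoint_mult: "cadjoint (A ** B) = cadjoint B ** cadjoint A"
  by (simp add: vec_eq_iff matrix_matrix_mult_def cadjoint_def mult.commute)

lemma cadjoint_cadjoint [simp]: "cadjoint (cadjoint A) = A"
  by (simp add: vec_eq_iff)

lemma cadjoint_transpose [simp]: "cadjoint (transpose A) = cnj_mat A"
  by (simp add: vec_eq_iff)

lemma cnj_mat_mult: "cnj_mat (A ** B) = cnj_mat A ** cnj_mat B"
  by (simp add: vec_eq_iff matrix_matrix_mult_def)

lemma cnj_mat_one [simp]: "cnj_mat (mat 1) = mat 1"
  by (simp add: vec_eq_iff mat_def)

lemma cnj_mat_cnj_mat [simp]: "cnj_mat (cnj_mat A) = A"
  by (simp add: vec_eq_iff)

lemma cnj_mat_cadjoint [simp]: "cnj_mat (cadjoint A) = transpose A"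
  by (simp add: vec_eq_iff)

lemma cadjoint_cnj_mat [simp]: "cadjoint (cnj_mat A) = transpose A"
  by (simp add: vec_eq_iff)

lemma transpose_cnj_mat [simp]: "transpose (cnj_mat A) = cadjoint A"
  by (simp add: vec_eq_iff)

lemma det_cnj_mat: "det (cnj_mat A) = cnj (det A)"
  by (simp add: det_def)

lemma pair_dot_adjoint: "pair_dot (A *v v) w = pair_dot v (transpose A *v w)"
proof -
  have "pair_dot (A *v v) w = (\<Sum>i\<in>UNIV. \<Sum>j\<in>UNIV. A $ i $ j * v $ j * w $ i)"
    by (simp add: pair_dot_def matrix_vector_mult_def sum_distrib_right)
  also have "\<dots> = (\<Sum>j\<in>UNIV. \<Sum>i\<in>UNIV. A $ i $ j * v $ j * w $ i)"
    by (rule sum.swap)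
  also have "\<dots> = pair_dot v (transpose A *v w)"
    by (simp add: pair_dot_def matrix_vector_mult_def sum_distrib_left mult_ac)
  finally show ?thesis .
qed

lemma herm_pair_dot: "herm v w = pair_dot (\<chi> i. cnj (v $ i)) w"
  by (simp add: herm_def pair_dot_def)

lemma herm_adjoint: "herm (A *v v) w = herm v (cadjoint A *v w)"
proof -
  have "(\<chi> i. cnj ((A *v v) $ i)) = cnj_mat A *v (\<chi> i. cnj (v $ i))"
    by (simp add: vec_eq_iff matrix_vector_mult_def)
  then show ?thesis
    by (simp add: herm_pair_dot pair_dot_adjoint)
qed

lemma pair_dot_scale:
  "pair_dot (k *s v) w = k * pair_dot v w" "pair_dot v (k *s w) = k * pair_dot v w"
  by (simp_all add: pair_dot_def sum_distrib_left mult_ac)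

lemma herm_scale:
  "herm (k *s v) w = cnj k * herm v w" "herm v (k *s w) = k * herm v w"
  by (simp_all add: herm_def sum_distrib_left mult_ac)

text \<open>Prepares the use of cyclicity of the trace for the W part of the Hermitian form.\<close>

lemma sum_herm_rows: "(\<Sum>i\<in>UNIV. herm (M $ i) (N $ i)) = trace (cadjoint M ** N)"
  by (simp add: herm_def trace_def matrix_matrix_mult_def) (rule sum.swap)

lemma unitary_right:
  fixes A :: "complex^'n^'n"
  shows "cadjoint A ** A = mat 1 \<Longrightarrow> A ** cadjoint A = mat 1"
  by (simp add: matrix_left_right_inverse)

lemma unitary_transpose:
  fixes A :: "complex^'n^'n"
  assumes "cadjoint A ** A = mat 1"
  shows "transpose A ** cnj_mat A = mat 1" "cnj_mat A ** transpose A = mat 1"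
  using arg_cong[OF assms, of cnj_mat] arg_cong[OF unitary_right[OF assms], of cnj_mat]
  by (simp_all add: cnj_mat_mult)

lemma scale_mat_mult:
  fixes M :: "'a::comm_semiring_1^'n^'m"
  shows "scale_mat k M ** N = scale_mat k (M ** N)" "N' ** scale_mat k M = scale_mat k (N' ** M)"
    "scale_mat k M *v x = k *s (M *v x)"
  by (simp_all add: vec_eq_iff matrix_matrix_mult_def matrix_vector_mult_def sum_distrib_left mult_ac)

text \<open>Splits an equation between two \<open>jmk\<close> terms into equations between their six
  blocks.\<close>

lemma arg_cong6:
  "\<lbrakk>a = a'; b = b'; c = c'; d = d'; e = e'; g = g'\<rbrakk> \<Longrightarrow> f a b c d e g = f a' b' c' d' e' g'"
  by simp

lemma transpose_scale_mat: "transpose (scale_mat k M) = scale_mat k (transpose M)"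
  by (simp add: vec_eq_iff)

lemma scale_mat_uminus: "scale_mat k (- M) = - scale_mat (k :: 'a::ring) M"
  by (simp add: vec_eq_iff)

lemma scale_mat_add: "scale_mat k (A + B) = scale_mat k A + scale_mat (k :: 'a::semiring) B"
  by (simp add: vec_eq_iff distrib_left)

lemma matrix_add_rdistrib:
  fixes A B :: "'a::semiring_1^'n^'m"
  shows "(A + B) ** C = A ** C + B ** C"
  by (simp add: vec_eq_iff matrix_matrix_mult_def sum.distrib distrib_right)

lemma transpose_add: "transpose (A + B) = transpose A + transpose B"
  by (simp add: vec_eq_iff)

lemma scale_mat_scale_mat:
  fixes M :: "'a::comm_semiring_1^'n^'m"
  shows "scale_mat k (scale_mat l M) = scale_mat (k * l) M"
  by (simp add: vec_eq_iff mult.assoc)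

lemma matrix_vector_scale:
  fixes A :: "'a::comm_semiring_1^'n^'m"
  shows "A *v (k *s x) = k *s (A *v x)"
  by (simp add: vec_eq_iff matrix_vector_mult_def sum_distrib_left mult_ac)

text \<open>For unitary A, \<open>cnj_mat A\<close> is the inverse transpose, so p and q transform
  dually to v; the scalars on q and p cancel those on s and t. Restriction to \<open>jordanC\<close>
  makes the map extensional, as \<open>Bij\<close> demands.\<close>

definition block_map :: "complex^5^5 \<Rightarrow> complex \<Rightarrow> complex \<Rightarrow> complex omat \<Rightarrow> complex omat" where
  "block_map A c d = (\<lambda>X\<in>jordanC. jmk (A *v coord_v X) (scale_mat (c * d) (A ** coord_W X ** transpose A))
    (c * coord_s X) (cnj d *s (cnj_mat A *v coord_p X)) (d * coord_t X) (cnj c *s (cnj_mat A *v coord_q X)))"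

lemma skew_congruence:
  fixes A :: "'a::comm_ring_1^'n^'n"
  assumes "transpose W = - W"
  shows "transpose (scale_mat k (A ** W ** transpose A)) = - scale_mat k (A ** W ** transpose A)"
proof -
  have "transpose (A ** W ** transpose A) = A ** (- W) ** transpose A"
    by (simp add: matrix_transpose_mul assms matrix_mul_assoc)
  also have "\<dots> = - (A ** W ** transpose A)"
    by (simp add: vec_eq_iff matrix_matrix_mult_def sum_negf)
  finally show ?thesis
    by (simp add: transpose_scale_mat scale_mat_uminus)
qed

lemma block_map_jmk:
  assumes "transpose W = - W"
  shows "block_map A c d (jmk v W s p t q) = jmk (A *v v) (scale_mat (c * d) (A ** W ** transpose A))
    (c * s) (cnj d *s (cnj_mat A *v p)) (d * t) (cnj c *s (cnj_mat A *v q))"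
  using assms by (simp add: block_map_def coord_jmk)

lemma block_map_compose:
  assumes "X \<in> jordan"
  shows "block_map A c d (block_map A' c' d' X) = block_map (A ** A') (c * c') (d * d') X"
  using assms
proof (elim jordan_jmk_cases)
  fix v W s p t q assume X: "X = jmk v W s p t q" and W: "transpose W = - W"
  show ?thesis
    unfolding X block_map_jmk[OF W]
    by (subst block_map_jmk[OF skew_congruence[OF W]], rule arg_cong6[where f = jmk])
      (simp_all add: matrix_vector_mul_assoc scale_mat_mult matrix_transpose_mul matrix_mul_assoc cnj_mat_mult
        matrix_vector_scale scale_mat_scale_mat mult_ac)
qed

lemma block_map_one:
  assumes "X \<in> jordan"
  shows "block_map (mat 1) 1 1 X = X"
  using assms
proof (elim jordan_jmk_cases)
  fix v W s p t q assume X: "X = jmk v W s p t q" and W: "transpose W = - W"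
  have "scale_mat 1 W = W" by (simp add: vec_eq_iff)
  then show ?thesis
    by (simp add: X block_map_jmk[OF W])
qed

definition block_params :: "((complex^5^5) \<times> complex \<times> complex) set" where
  "block_params = {(A, c, d). cadjoint A ** A = mat 1 \<and> cmod c = 1 \<and> cmod d = 1 \<and> (c * d)^2 * det A = 1}"

lemma block_map_E6:
  assumes "(A, c, d) \<in> block_params"
  shows "block_map A c d \<in> carrier E6"
proof -
  have A: "cadjoint A ** A = mat 1" and cd': "c * cnj c = 1" "d * cnj d = 1" and det: "(c * d)^2 * det A = 1"
    using assms complex_norm_square[of c] complex_norm_square[of d] by (auto simp: block_params_def)
  have cd: "cnj c * c = 1" "cnj d * d = 1"
    using cd' by (simp_all add: mult.commute)
  have unit': "z * (x * (cnj z * y)) = x * y" if "z * cnj z = 1" for x y z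
  proof -
    have "z * (x * (cnj z * y)) = (z * cnj z) * (x * y)"
      by (simp only: mult_ac)
    with that show ?thesis by simp
  qed
  note T = unitary_transpose[OF A]
  have maps: "block_map B e f X \<in> jordan" if "X \<in> jordan" for B e f X
    using that by (simp add: block_map_def)
  show ?thesis
  proof (rule E6I)
    have "bij_betw (block_map A c d) jordan jordan"
    proof (rule bij_betw_byWitness[where f' = "block_map (cadjoint A) (cnj c) (cnj d)"])
    qed (auto simp: block_map_compose A unitary_right[OF A] cd cd' block_map_one maps)
    then show "block_map A c d \<in> Bij jordanC"
      by (simp add: Bij_def block_map_def)
  next
    fix X Y :: "complex omat" assume "X \<in> jordan" "Y \<in> jordan"
    then obtain v W s p t q v' W' s' p' t' q' where
      X: "X = jmk v W s p t q" "transpose W = - W" and Y: "Y = jmk v' W' s' p' t' q'" "transpose W' = - W'"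
      by (metis jordan_jmk_cases)
    have WW: "transpose (W + W') = - (W + W')"
      using X(2) Y(2) by (simp add: transpose_add)
    show "block_map A c d (X + Y) = block_map A c d X + block_map A c d Y"
      unfolding X(1) Y(1) jmk_add block_map_jmk[OF WW] block_map_jmk[OF X(2)] block_map_jmk[OF Y(2)]
      by (rule arg_cong6[where f = jmk])
        (simp_all add: matrix_vector_right_distrib matrix_add_ldistrib matrix_add_rdistrib scale_mat_add
          vector_add_ldistrib distrib_left)
    \<comment> \<open>Unitarity cancels the inner factor \<open>cadjoint A ** A\<close>, and
      cyclicity brings \<open>transpose A\<close> next to \<open>cnj_mat A\<close>.\<close>
    have "trace (cadjoint (A ** W ** transpose A) ** (A ** W' ** transpose A)) =
        trace (cnj_mat A ** (cadjoint W ** (cadjoint A ** A) ** W' ** transpose A))"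
      by (simp add: cadjoint_mult matrix_mul_assoc)
    also have "\<dots> = trace (cadjoint W ** W' ** (transpose A ** cnj_mat A))"
      by (subst trace_mul_sym) (simp add: A matrix_mul_assoc)
    finally have tr: "(\<Sum>i\<in>UNIV. herm ((A ** W ** transpose A) $ i) ((A ** W' ** transpose A) $ i)) =
        (\<Sum>i\<in>UNIV. herm (W $ i) (W' $ i))"
      by (simp add: sum_herm_rows T)
    have s: "scale_mat k M $ i = k *s (M $ i)" for k and M :: "complex^5^5" and i
      by (simp add: vec_eq_iff)
    have unit: "cnj z * cnj x * z * y = cnj x * y" if "cnj z * z = 1" for x y z
    proof -
      have "cnj z * cnj x * z * y = (cnj z * z) * (cnj x * y)"
        by (simp only: mult_ac)
      with that show ?thesis by simp
    qed
    have "c * d * cnj c * cnj d = (c * cnj c) * (d * cnj d)"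
      by (simp only: mult_ac)
    then have cdcd: "c * d * cnj c * cnj d = 1"
      by (simp add: cd')
    have hA: "herm (A *v x) (A *v y) = herm x y" "herm (cnj_mat A *v x) (cnj_mat A *v y) = herm x y" for x y
      by (simp_all add: herm_adjoint matrix_vector_mul_assoc A T)
    show "jherm (block_map A c d X) (block_map A c d Y) = jherm X Y"
      unfolding X(1) Y(1) block_map_jmk[OF X(2)] block_map_jmk[OF Y(2)]
        jherm_jmk[OF skew_congruence[OF X(2)] skew_congruence[OF Y(2)]] jherm_jmk[OF X(2) Y(2)]
      using cdcd cd cd'
      by (simp add: s herm_scale hA tr sum_distrib_left[symmetric] mult.assoc[symmetric])
        (simp only: unit)
  next
    fix k :: complex and X :: "complex omat" assume "X \<in> jordan"
    then obtain v W s p t q where X: "X = jmk v W s p t q" "transpose W = - W"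
      by (metis jordan_jmk_cases)
    have w: "(\<chi> i. k *s W $ i) = scale_mat k W" for W :: "complex^5^5"
      by (simp add: vec_eq_iff)
    have kW: "transpose (scale_mat k W) = - (scale_mat k W)"
      using X(2) by (simp add: transpose_scale_mat scale_mat_uminus)
    show "block_map A c d (omat_scale k X) = omat_scale k (block_map A c d X)"
      unfolding X(1) jmk_scale w block_map_jmk[OF kW] block_map_jmk[OF X(2)]
      by (rule arg_cong6[where f = jmk])
        (simp_all add: matrix_vector_scale scale_mat_mult scale_mat_scale_mat mult_ac)
    have pA: "pair_dot (A *v x) (cnj_mat A *v y) = pair_dot x y" "pair_dot (cnj_mat A *v x) (A *v y) = pair_dot x y" for x y
      by (simp_all add: pair_dot_adjoint matrix_vector_mul_assoc A T)
    have "(A ** W ** transpose A) *v (cnj_mat A *v q) = A *v (W *v q)"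
      by (simp add: matrix_vector_mul_assoc matrix_mul_assoc[symmetric] T)
    moreover have "pf (A *v v) (scale_mat (c * d) (A ** W ** transpose A)) = pf v W"
    proof -
      \<comment> \<open>The form is quadratic in W, hence the square of c d, which the constraint in
        \<open>block_params\<close> balances against det A.\<close>
      have "pf (A *v v) (scale_mat (c * d) M) = (c * d)^2 * pf (A *v v) M" for M
        by (simp add: pf_polar_def algebra_simps power2_eq_square)
      then have "pf (A *v v) (scale_mat (c * d) (A ** W ** transpose A)) = (c * d)^2 * (det A * pf v W)"
        by (simp only: pf_congruence[OF X(2)])
      also have "\<dots> = pf v W"
        using det by (simp only: mult.assoc[symmetric]) simp
      finally show ?thesis .
    qed
    ultimately show "jdet (block_map A c d X) = jdet X"
      unfolding X(1) block_map_jmk[OF X(2)] jdet_jmk[OF skew_congruence[OF X(2)]] jdet_jmk[OF X(2)]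
      using cd cd'
      by (simp add: pair_dot_scale scale_mat_mult matrix_vector_scale pA mult.assoc[symmetric])
        (simp add: mult_ac unit')
  qed
qed

lemma block_map_fixed:
  assumes "(A, c, d) \<in> block_params"
  shows "block_map A c d \<in> E6_gamma \<inter> E6_gammaH_rho2"
  unfolding fixed_group_iff
proof (intro conjI ballI)
  fix X :: "complex omat" assume "X \<in> jordan"
  then obtain v W s p t q where X: "X = jmk v W s p t q" "transpose W = - W"
      by (metis jordan_jmk_cases)
  have n: "B *v (- x) = - (B *v x)" "k *s (- x) = - (k *s x)" for B :: "complex^5^5" and k x
    by (simp_all add: vec_eq_iff matrix_vector_mult_def sum_negf)
  have m: "scale_mat (c * d) (A ** (- W) ** transpose A) = - scale_mat (c * d) (A ** W ** transpose A)"
    by (simp add: vec_eq_iff matrix_matrix_mult_def sum_negf)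
  show "block_map A c d (gamma X) = gamma (block_map A c d X)"
    by (simp add: X gamma_jmk block_map_jmk n)
  show "block_map A c d (gammaH_rho2 X) = gammaH_rho2 (block_map A c d X)"
    by (simp add: X gammaH_rho2_jmk block_map_jmk transpose_uminus n m)
qed (rule block_map_E6[OF assms])

section \<open>Every element of the centralizer is a block map\<close>

lemma cmod_eq_1_iff: "cmod z = 1 \<longleftrightarrow> z * cnj z = 1"
proof -
  have "z * cnj z = 1 \<longleftrightarrow> (cmod z)\<^sup>2 = 1"
    by (metis complex_norm_square of_real_eq_1_iff)
  also have "\<dots> \<longleftrightarrow> cmod z = 1"
    by (smt (verit) norm_ge_zero power2_eq_1_iff)
  finally show ?thesis ..
qed

text \<open>Skewness enters because \<open>jmk\<close> sees only the entries of W above the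
  diagonal.\<close>

lemma jmk_eq_iff:
  assumes "transpose W = - W" "transpose W' = - W'"
  shows "jmk v W s p t q = jmk v' W' s' p' t' q' \<longleftrightarrow>
    v = v' \<and> W = W' \<and> s = s' \<and> p = p' \<and> t = t' \<and> q = q'"
  using coord_jmk[where v = v and W = W and s = s and p = p and t = t and q = q]
    coord_jmk[where v = v' and W = W' and s = s' and p = p' and t = t' and q = q'] assms
  by metis

lemma jordanC_add: "X \<in> jordanC \<Longrightarrow> Y \<in> jordanC \<Longrightarrow> X + Y \<in> jordanC"
  by (elim jordan_jmk_cases) (simp add: jmk_add)

lemma pair_dot_zero [simp]: "pair_dot 0 w = 0" "pair_dot v 0 = 0"
  by (simp_all add: pair_dot_def)

lemma pair_dot_axis: "pair_dot (axis i 1) w = w $ i"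
  by (simp add: pair_dot_def axis_def if_distrib[where f = "\<lambda>x. x * _"] cong: if_cong)

lemma pair_dot_ext:
  assumes "\<And>v. pair_dot v a = pair_dot v b"
  shows "a = b"
  using assms[of "axis _ 1"] by (simp add: pair_dot_axis vec_eq_iff)

lemma pair_dot_matrix_ext:
  assumes "\<And>p q. pair_dot p (M *v q) = pair_dot p (N *v q)"
  shows "M = N"
  using pair_dot_ext[OF assms] by (simp add: matrix_eq)

text \<open>
  If $\sigma(0, q) \neq 0$ for some $q$, then $\kappa(0, \cdot)$ vanishes identically, since a vector
  space is not the union of two proper subspaces; but then $q$ would always be proportional to one
  fixed vector.
\<close>

lemma mixed_form_rigidity:
  fixes A :: "complex^5^5" and \<sigma> :: "complex \<Rightarrow> complex^5 \<Rightarrow> complex" and \<kappa> :: "complex \<Rightarrow> complex^5 \<Rightarrow> complex^5"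
  assumes A: "cadjoint A ** A = mat 1"
    and add: "\<And>s s' q q'. \<sigma> (s + s') (q + q') = \<sigma> s q + \<sigma> s' q'"
      "\<And>s s' q q'. \<kappa> (s + s') (q + q') = \<kappa> s q + \<kappa> s' q'"
    and scale: "\<And>k s q. \<sigma> (k * s) (k *s q) = k * \<sigma> s q" "\<And>k s q. \<kappa> (k * s) (k *s q) = k *s \<kappa> s q"
    and form: "\<And>v s q. s * pair_dot v q = \<sigma> s q * pair_dot (A *v v) (\<kappa> s q)"
  obtains c where "c \<noteq> 0" "\<And>s q. \<sigma> s q = c * s" "\<And>s q. \<kappa> s q = inverse c *s (cnj_mat A *v q)"
proof -
  note T = unitary_transpose[OF A]
  \<comment> \<open>Since v is arbitrary, the scalar identity becomes a vector identity. Its case s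
    = 0 says that \<sigma> 0 q or \<kappa> 0 q vanishes.\<close>
  have eq: "s *s q = \<sigma> s q *s (transpose A *v \<kappa> s q)" for s q
    by (rule pair_dot_ext) (simp add: pair_dot_scale form[of s _ q] pair_dot_adjoint)
  have inj: "x = 0" if "transpose A *v x = 0" for x
    using that T(2) by (metis matrix_vector_mul_assoc matrix_vector_mul_lid matrix_vector_mult_0_right)
  have or: "\<sigma> 0 q = 0 \<or> \<kappa> 0 q = 0" for q
    using eq[of 0 q] inj[of "\<kappa> 0 q"] by auto
  have \<sigma>0: "\<sigma> 0 q = 0" for q
  proof (rule ccontr)
    assume q: "\<sigma> 0 q \<noteq> 0"
    have \<kappa>0: "\<kappa> 0 x = 0" for x
    proof (cases "\<sigma> 0 x = 0")
      case True
      then have "\<sigma> 0 (x + q) \<noteq> 0"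
        using q add(1)[of 0 0 x q] by simp
      with q or have "\<kappa> 0 (x + q) = 0" "\<kappa> 0 q = 0" by blast+
      then show ?thesis using add(2)[of 0 0 x q] by simp
    qed (use or in blast)
    \<comment> \<open>Every x is now a multiple of the single vector k, since \<kappa> 1 x =
      \<kappa> 1 0 + \<kappa> 0 x = \<kappa> 1 0.\<close>
    define k where "k = transpose A *v \<kappa> 1 0"
    have "x = \<sigma> 1 x *s k" for x
      using eq[of 1 x] add(2)[of 1 0 0 x] \<kappa>0 by (simp add: k_def)
    then have k: "x $ i = \<sigma> 1 x * k $ i" for x i
      by (metis vector_smult_component)
    \<comment> \<open>The first equation makes k_1 nonzero, so the second makes \<sigma> vanish at
      the second basis vector, against the third.\<close>
    have "1 = \<sigma> 1 (axis 1 1) * k $ 1" "0 = \<sigma> 1 (axis 2 1) * k $ 1" "1 = \<sigma> 1 (axis 2 1) * k $ 2"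
      using k[of "axis 1 1" 1] k[of "axis 2 1" 1] k[of "axis 2 1" 2] by (simp_all add: axis_def)
    then show False by auto
  qed
  define c where "c = \<sigma> 1 0"
  have \<sigma>: "\<sigma> s q = c * s" for s q
    using add(1)[of s 0 0 q] scale(1)[of s 1 0] \<sigma>0 by (simp add: c_def mult.commute)
  have k1: "q = c *s (transpose A *v \<kappa> 1 q)" for q
    using eq[of 1 q] by (simp add: \<sigma>)
  have c0: "c \<noteq> 0"
    using k1[of "axis 1 1"] by (metis axis_nth vector_smult_component mult_zero_left zero_neq_one)
  have inv: "\<kappa> 1 q = inverse c *s (cnj_mat A *v q)" for q
  proof -
    have "cnj_mat A *v q = c *s \<kappa> 1 q"
      using arg_cong[OF k1[of q], of "\<lambda>x. cnj_mat A *v x"]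
      by (simp only: matrix_vector_scale matrix_vector_mul_assoc T matrix_vector_mul_lid)
    then show ?thesis
      by (simp add: c0)
  qed
  \<comment> \<open>Homogeneity then gives \<kappa> s 0 = 0 and additivity \<kappa> 0 q = \<kappa> 1
    q, so the formula for s = 1 extends to every s.\<close>
  have "\<kappa> 1 0 = 0"
    using inv[of 0] by simp
  then have "\<kappa> s q = inverse c *s (cnj_mat A *v q)" for s q
    using add(2)[of 1 0 0 q] scale(2)[of s 1 0] add(2)[of s 0 0 q] inv[of q] by simp
  with c0 \<sigma> show thesis by (rule that)
qed

lemma zero_skew [simp]: "transpose (0 :: 'a::ring_1^'n^'n) = - 0"
  by (simp add: vec_eq_iff)

lemma jherm_parts:
  "jherm (jmk v 0 0 0 0 0) (jmk v' 0 0 0 0 0) = herm v v'"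
  "jherm (jmk 0 0 s 0 0 0) (jmk 0 0 s' 0 0 0) = cnj s * s'"
  "jherm (jmk 0 0 0 0 t 0) (jmk 0 0 0 0 t' 0) = cnj t * t'"
  by (simp_all add: jherm_jmk herm_def)

lemma fixed_group_block_map:
  assumes "f \<in> E6_gamma \<inter> E6_gammaH_rho2"
  obtains A c d where "(A, c, d) \<in> block_params" "f = block_map A c d"
proof -
  from assms have fE: "f \<in> carrier E6"
    and comm: "\<And>X. X \<in> jordan \<Longrightarrow> f (gamma X) = gamma (f X)"
      "\<And>X. X \<in> jordan \<Longrightarrow> f (gammaH_rho2 X) = gammaH_rho2 (f X)"
    unfolding fixed_group_iff by auto
  have add: "f (X + Y) = f X + f Y" if "X \<in> jordan" "Y \<in> jordan" for X Y
    using fE that by (simp add: E6_def IsoC_def)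
  have scale: "f (omat_scale k X) = omat_scale k (f X)" if "X \<in> jordan" for k X
    using fE that by (simp add: E6_def IsoC_def)
  have det: "jdet (f X) = jdet X" if "X \<in> jordan" for X
    using fE that by (simp add: E6_def)
  have herm: "jherm (f X) (f Y) = jherm X Y" if "X \<in> jordan" "Y \<in> jordan" for X Y
    using fE that by (simp add: E6_def)
  \<comment> \<open>Negation is scaling by -1, which gives the value of f where an involution acts
    on a block by -1.\<close>
  have neg: "omat_scale (- 1) (jmk v W s p t q) = jmk (- v) (- W) (- s) (- p) (- t) (- q)" for v W s p t q
    unfolding jmk_scale by (rule arg_cong6[where f = jmk]) (simp_all add: vec_eq_iff)
  have self_neg: "x = - x \<longleftrightarrow> x = 0" "- x = x \<longleftrightarrow> x = 0" for x :: complex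
    by auto
  have self_neg_vec: "x = - x \<longleftrightarrow> x = 0" "- x = x \<longleftrightarrow> x = 0" for x :: "complex^5"
    by (auto simp: vec_eq_iff)
  have self_neg_mat: "x = - x \<longleftrightarrow> x = 0" "- x = x \<longleftrightarrow> x = 0" for x :: "complex^5^5"
    by (auto simp: vec_eq_iff)
  have block: "\<exists>v W s p t q. f (jmk v0 W0 s0 p0 t0 q0) = jmk v W s p t q \<and> transpose W = - W" for v0 W0 s0 p0 t0 q0
    using E6_closed[OF fE jmk_in_jordan] by (metis jordan_jmk_cases)
  \<comment> \<open>One family per joint eigenspace of gamma and gamma_H rho_2: signs (+,+) for a,
    (+,-) for b, (-,+) for \<sigma> and \<kappa>, (-,-) for \<tau> and \<pi>.\<close>
  define a where "a v = coord_v (f (jmk v 0 0 0 0 0))" for v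
  define b where "b W = coord_W (f (jmk 0 W 0 0 0 0))" for W
  define \<sigma> where "\<sigma> s q = coord_s (f (jmk 0 0 s 0 0 q))" for s q
  define \<kappa> where "\<kappa> s q = coord_q (f (jmk 0 0 s 0 0 q))" for s q
  define \<tau> where "\<tau> t p = coord_t (f (jmk 0 0 0 p t 0))" for t p
  define \<pi> where "\<pi> t p = coord_p (f (jmk 0 0 0 p t 0))" for t p
  have fa: "f (jmk v 0 0 0 0 0) = jmk (a v) 0 0 0 0 0" for v
  proof -
    obtain v' W s p t q where Y: "f (jmk v 0 0 0 0 0) = jmk v' W s p t q" and W: "transpose W = - W"
      using block by blast
    have W': "transpose (- W) = - (- W)" using W by (simp add: transpose_uminus)
    \<comment> \<open>Commuting with the involutions equates each coordinate outside the block with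
      its own negative, so it vanishes.\<close>
    show ?thesis
      using comm[of "jmk v 0 0 0 0 0"] W W'
      by (simp add: gamma_jmk gammaH_rho2_jmk Y a_def jmk_eq_iff coord_jmk self_neg self_neg_vec self_neg_mat)
  qed
  have fb: "f (jmk 0 W 0 0 0 0) = jmk 0 (b W) 0 0 0 0" "transpose (b W) = - b W" for W
  proof -
    obtain v W1 s p t q where Y: "f (jmk 0 W 0 0 0 0) = jmk v W1 s p t q" and W1: "transpose W1 = - W1"
      using block by blast
    have "jmk 0 (- W) 0 0 0 0 = omat_scale (- 1) (jmk 0 W 0 0 0 0)"
      unfolding neg by simp
    then have "f (jmk 0 (- W) 0 0 0 0) = jmk (- v) (- W1) (- s) (- p) (- t) (- q)"
      using scale[of "jmk 0 W 0 0 0 0" "- 1"] unfolding Y neg by simp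
    moreover have W': "transpose (- W1) = - (- W1)" using W1 by (simp add: transpose_uminus)
    ultimately show "f (jmk 0 W 0 0 0 0) = jmk 0 (b W) 0 0 0 0" "transpose (b W) = - b W"
      using comm[of "jmk 0 W 0 0 0 0"] W1
      by (simp_all add: gamma_jmk gammaH_rho2_jmk Y b_def jmk_eq_iff coord_jmk self_neg self_neg_vec self_neg_mat)
  qed
  have fs: "f (jmk 0 0 s 0 0 q) = jmk 0 0 (\<sigma> s q) 0 0 (\<kappa> s q)" for s q
  proof -
    obtain v W s' p t q' where Y: "f (jmk 0 0 s 0 0 q) = jmk v W s' p t q'" and W: "transpose W = - W"
      using block by blast
    have "jmk 0 0 (- s) 0 0 (- q) = omat_scale (- 1) (jmk 0 0 s 0 0 q)"
      unfolding neg by simp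
    then have "f (jmk 0 0 (- s) 0 0 (- q)) = jmk (- v) (- W) (- s') (- p) (- t) (- q')"
      using scale[of "jmk 0 0 s 0 0 q" "- 1"] unfolding Y neg by simp
    moreover have W': "transpose (- W) = - (- W)" using W by (simp add: transpose_uminus)
    ultimately show ?thesis
      using comm[of "jmk 0 0 s 0 0 q"] W
      by (simp add: gamma_jmk gammaH_rho2_jmk Y \<sigma>_def \<kappa>_def jmk_eq_iff coord_jmk self_neg self_neg_vec self_neg_mat)
  qed
  have ft: "f (jmk 0 0 0 p t 0) = jmk 0 0 0 (\<pi> t p) (\<tau> t p) 0" for t p
  proof -
    obtain v W s' p' t' q' where Y: "f (jmk 0 0 0 p t 0) = jmk v W s' p' t' q'" and W: "transpose W = - W"
      using block by blast
    have "jmk 0 0 0 (- p) (- t) 0 = omat_scale (- 1) (jmk 0 0 0 p t 0)"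
      unfolding neg by simp
    then have "f (jmk 0 0 0 (- p) (- t) 0) = jmk (- v) (- W) (- s') (- p') (- t') (- q')"
      using scale[of "jmk 0 0 0 p t 0" "- 1"] unfolding Y neg by simp
    moreover have W': "transpose (- W) = - (- W)" using W by (simp add: transpose_uminus)
    ultimately show ?thesis
      using comm[of "jmk 0 0 0 p t 0"] W
      by (simp add: gamma_jmk gammaH_rho2_jmk Y \<tau>_def \<pi>_def jmk_eq_iff coord_jmk self_neg self_neg_vec self_neg_mat)
  qed
  have f_eq: "f (jmk v W s p t q) = jmk (a v) (b W) (\<sigma> s q) (\<pi> t p) (\<tau> t p) (\<kappa> s q)" for v W s p t q
  proof -
    have "f (jmk v W s p t q) = f (jmk v 0 0 0 0 0 + (jmk 0 W 0 0 0 0 + (jmk 0 0 s 0 0 q + jmk 0 0 0 p t 0)))"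
      by (simp add: jmk_add)
    also have "\<dots> = f (jmk v 0 0 0 0 0) + (f (jmk 0 W 0 0 0 0) + (f (jmk 0 0 s 0 0 q) + f (jmk 0 0 0 p t 0)))"
      by (simp only: add jordanC_add jmk_in_jordan)
    finally show ?thesis
      by (simp add: fa fb fs ft jmk_add)
  qed
  have z0: "(\<chi> i. 0) = (0 :: complex^5^5)"
    by (simp add: vec_eq_iff)

  define A where "A = matrix a"
  have "Vector_Spaces.linear (*s) (*s) a"
  proof unfold_locales
    show "a (x + y) = a x + a y" for x y
      using add[of "jmk x 0 0 0 0 0" "jmk y 0 0 0 0 0"] by (simp add: fa jmk_add jmk_eq_iff)
    show "a (k *s x) = k *s a x" for k x
      using scale[of "jmk x 0 0 0 0 0" k] by (simp add: fa jmk_scale z0 jmk_eq_iff)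
  qed
  then have a: "a x = A *v x" for x
    by (simp add: A_def matrix_works)
  \<comment> \<open>The Hermitian form is the bilinear pairing with a conjugated first argument;
    conjugating v once more makes that argument arbitrary, so \<open>pair_dot_matrix_ext\<close>
    applies.\<close>
  have "pair_dot (\<chi> i. cnj (v $ i)) (cadjoint A ** A *v w) = pair_dot (\<chi> i. cnj (v $ i)) w" for v w
    using herm[of "jmk v 0 0 0 0 0" "jmk w 0 0 0 0 0"]
    by (simp add: fa a jherm_parts herm_adjoint matrix_vector_mul_assoc flip: herm_pair_dot)
  from this[of "\<chi> i. cnj (_ $ i)"] have A: "cadjoint A ** A = mat 1"
    by (intro pair_dot_matrix_ext) simp
  note T = unitary_transpose[OF A]

  have \<sigma>\<kappa>: "\<sigma> (s + s') (q + q') = \<sigma> s q + \<sigma> s' q'" "\<kappa> (s + s') (q + q') = \<kappa> s q + \<kappa> s' q'" for s s' q q'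
    using add[of "jmk 0 0 s 0 0 q" "jmk 0 0 s' 0 0 q'"] by (simp_all add: fs jmk_add jmk_eq_iff)
  have \<sigma>\<kappa>': "\<sigma> (k * s) (k *s q) = k * \<sigma> s q" "\<kappa> (k * s) (k *s q) = k *s \<kappa> s q" for k s q
    using scale[of "jmk 0 0 s 0 0 q" k] by (simp_all add: fs jmk_scale z0 jmk_eq_iff)
  \<comment> \<open>With W = p = t = 0 only s v.q survives in the determinant. Comparing
    \<open>f_eq\<close> with \<open>fa\<close> shows that b, \<tau> and \<pi> vanish at zero, so the
    same holds for the image.\<close>
  have \<sigma>\<kappa>f: "s * pair_dot v q = \<sigma> s q * pair_dot (A *v v) (\<kappa> s q)" for v s q
    using det[of "jmk v 0 s 0 0 q"] f_eq[of v 0 s 0 0 q] f_eq[of v 0 0 0 0 0] fa[of v] fb(2)[of 0]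
    by (simp add: fs a jdet_jmk jmk_eq_iff pf_polar_def)
  obtain c where c: "c \<noteq> 0" "\<And>s q. \<sigma> s q = c * s" "\<And>s q. \<kappa> s q = inverse c *s (cnj_mat A *v q)"
    using mixed_form_rigidity[OF A \<sigma>\<kappa> \<sigma>\<kappa>' \<sigma>\<kappa>f] by metis
  have \<tau>\<pi>: "\<tau> (t + t') (p + p') = \<tau> t p + \<tau> t' p'" "\<pi> (t + t') (p + p') = \<pi> t p + \<pi> t' p'" for t t' p p'
    using add[of "jmk 0 0 0 p t 0" "jmk 0 0 0 p' t' 0"] by (simp_all add: ft jmk_add jmk_eq_iff)
  have \<tau>\<pi>': "\<tau> (k * t) (k *s p) = k * \<tau> t p" "\<pi> (k * t) (k *s p) = k *s \<pi> t p" for k t p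
    using scale[of "jmk 0 0 0 p t 0" k] by (simp_all add: ft jmk_scale z0 jmk_eq_iff)
  have \<tau>\<pi>f: "t * pair_dot v p = \<tau> t p * pair_dot (A *v v) (\<pi> t p)" for v t p
    using det[of "jmk v 0 0 p t 0"] f_eq[of v 0 0 p t 0] f_eq[of v 0 0 0 0 0] fa[of v] fb(2)[of 0]
    by (simp add: ft a jdet_jmk jmk_eq_iff pf_polar_def)
  obtain d where d: "d \<noteq> 0" "\<And>t p. \<tau> t p = d * t" "\<And>t p. \<pi> t p = inverse d *s (cnj_mat A *v p)"
    using mixed_form_rigidity[OF A \<tau>\<pi> \<tau>\<pi>' \<tau>\<pi>f] by metis
  \<comment> \<open>The unit vectors in the s and t directions keep norm 1, so |c| = |d| = 1 and the
    inverses become conjugates.\<close>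
  have cd: "c * cnj c = 1" "d * cnj d = 1"
    using herm[of "jmk 0 0 1 0 0 0" "jmk 0 0 1 0 0 0"] herm[of "jmk 0 0 0 0 1 0" "jmk 0 0 0 0 1 0"]
    by (simp_all add: fs ft c(2,3) d(2,3) jherm_parts mult.commute)
  then have inv: "inverse c = cnj c" "inverse d = cnj d"
    by (simp_all add: inverse_unique)
  have n: "cmod c = 1" "cmod d = 1"
    using cd by (simp_all add: cmod_eq_1_iff)

  have b: "b W = scale_mat (c * d) (A ** W ** transpose A)" if W: "transpose W = - W" for W
  proof -
    \<comment> \<open>At v = s = t = 0 the determinant is p.(W q). Moving the unitary factors across
      the pairing expresses W through b W, which is then inverted.\<close>
    have "pair_dot p (W *v q) = pair_dot p (scale_mat (cnj c * cnj d) (cadjoint A ** b W ** cnj_mat A) *v q)" for p q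
      using det[of "jmk 0 W 0 p 0 q"] f_eq[of 0 W 0 p 0 q]
      by (simp add: jdet_jmk W fb(2) c d inv a pf_polar_def pair_dot_scale pair_dot_adjoint matrix_vector_scale
          scale_mat_mult matrix_vector_mul_assoc matrix_mul_assoc mult_ac)
    then have W_eq: "W = scale_mat (cnj c * cnj d) (cadjoint A ** b W ** cnj_mat A)"
      by (rule pair_dot_matrix_ext)
    have "A ** (cadjoint A ** b W ** cnj_mat A) ** transpose A = (A ** cadjoint A) ** b W ** (cnj_mat A ** transpose A)"
      by (simp only: matrix_mul_assoc)
    also have "\<dots> = b W"
      by (simp add: T unitary_right[OF A])
    finally have "scale_mat (c * d) (A ** W ** transpose A) = scale_mat (c * d * (cnj c * cnj d)) (b W)"
      by (subst W_eq) (simp add: scale_mat_mult scale_mat_scale_mat)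
    also have "c * d * (cnj c * cnj d) = (c * cnj c) * (d * cnj d)"
      by (simp only: mult_ac)
    also have "\<dots> = 1"
      by (simp add: cd)
    finally show ?thesis
      by (simp add: vec_eq_iff)
  qed
  have "(c * d)^2 * det A = 1"
  proof -
    \<comment> \<open>The test pair e_1 and e_2 wedge e_3 + e_4 wedge e_5 has cubic value 1, so its
      invariance isolates the scalar.\<close>
    define W :: "complex^5^5" where "W = skew5 0 0 0 0 1 0 0 0 0 1"
    have W: "transpose W = - W"
      by (simp add: W_def vec_eq_iff forall_5 skew5_def)
    have "pf (axis 1 1) W = pf (A *v axis 1 1) (scale_mat (c * d) (A ** W ** transpose A))"
      using det[of "jmk (axis 1 1) W 0 0 0 0"] f_eq[of "axis 1 1" W 0 0 0 0] skew_congruence[OF W]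
      by (simp add: jdet_jmk W c d a b)
    also have "\<dots> = (c * d)^2 * pf (A *v axis 1 1) (A ** W ** transpose A)"
      by (simp add: pf_polar_def algebra_simps power2_eq_square)
    also have "\<dots> = (c * d)^2 * det A * pf (axis 1 1) W"
      by (simp add: pf_congruence[OF W])
    finally show ?thesis
      by (simp add: W_def pf_polar_def skew5_def axis_def)
  qed
  with A n have "(A, c, d) \<in> block_params"
    by (simp add: block_params_def)
  moreover have "f = block_map A c d"
  proof
    fix X :: "complex omat"
    show "f X = block_map A c d X"
    proof (cases "X \<in> jordan")
      case True
      then show ?thesis
        by (elim jordan_jmk_cases) (simp add: f_eq block_map_jmk a b c d inv)
    next
      case False
      then show ?thesis
        using Bij_imp_extensional[OF E6_Bij[OF fE]] by (simp add: block_map_def extensional_def)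
    qed
  qed
  ultimately show thesis by (rule that)
qed

section \<open>The parametrisation by \<open>U(1) \<times> U(1) \<times> SU(5)\<close>\<close>

text \<open>The exponents make (c d)^2 det A = w^20 w^(-20) = 1. Conjugating S puts the fifth roots
  into the kernel as (1, \<nu>^k, \<nu>^k E): A = E means S = w^(-4) E, and w^(-4) = w when w^5 =
  1.\<close>

definition fixed_group_map :: "u1_u1_su5 \<Rightarrow> complex omat \<Rightarrow> complex omat" where
  "fixed_group_map = (\<lambda>(z, w, S). block_map (scale_mat (cnj w ^ 4) (cnj_mat S)) (z * w ^ 5) (cnj z * w ^ 5))"

lemma group_U1: "group U1"
proof (rule groupI)
  fix x assume "x \<in> carrier U1"
  then show "\<exists>y\<in>carrier U1. y \<otimes>\<^bsub>U1\<^esub> x = \<one>\<^bsub>U1\<^esub>"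
    by (intro bexI[of _ "cnj x"]) (auto simp: U1_def cmod_eq_1_iff mult.commute)
qed (auto simp: U1_def norm_mult)

lemma det_cadjoint: "det (cadjoint A) = cnj (det A)"
proof -
  have "cadjoint A = transpose (cnj_mat A)" by simp
  then show ?thesis by (simp only: det_transpose det_cnj_mat)
qed

lemma cadjoint_one [simp]: "cadjoint (mat 1) = mat 1"
  by (simp add: vec_eq_iff mat_def)

lemma group_SU: "group (SU :: (complex^'n^'n) monoid)"
proof (rule groupI)
  fix A B :: "complex^'n^'n" assume A: "A \<in> carrier SU" and B: "B \<in> carrier SU"
  have "cadjoint (A ** B) ** (A ** B) = cadjoint B ** (cadjoint A ** A) ** B"
    by (simp add: cadjoint_mult matrix_mul_assoc)
  with A B show "A \<otimes>\<^bsub>SU\<^esub> B \<in> carrier SU"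
    by (simp add: SU_def det_mul)
next
  fix A :: "complex^'n^'n" assume "A \<in> carrier SU"
  then show "\<exists>B\<in>carrier SU. B \<otimes>\<^bsub>SU\<^esub> A = \<one>\<^bsub>SU\<^esub>"
    by (intro bexI[of _ "cadjoint A"]) (auto simp: SU_def det_cadjoint unitary_right)
qed (auto simp: SU_def matrix_mul_assoc)

lemma group_U1_U1_SU5: "group U1_U1_SU5"
  by (intro DirProd_group group_U1 group_SU)

lemma det_scale_mat: "det (scale_mat k (A :: 'a::comm_ring_1^'n^'n)) = k ^ CARD('n) * det A"
proof -
  have "scale_mat k A = (\<chi> i. k *s A $ i)" by (simp add: vec_eq_iff)
  then show ?thesis
    using det_rows_mul[of "\<lambda>_. k" "\<lambda>i. A $ i"] by simp
qed

lemma cadjoint_scale_mat: "cadjoint (scale_mat k A) = scale_mat (cnj k) (cadjoint A)"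
  by (simp add: vec_eq_iff)

lemma cnj_mat_scale_mat: "cnj_mat (scale_mat k A) = scale_mat (cnj k) (cnj_mat A)"
  by (simp add: vec_eq_iff)

lemma scale_mat_one: "scale_mat (1 :: 'a::monoid_mult) A = A"
  by (simp add: vec_eq_iff)

lemma unit_powers:
  assumes "cmod w = 1"
  shows "w * cnj w = 1" "cnj w ^ n * w ^ n = 1"
proof -
  show w: "w * cnj w = 1" using assms by (simp add: cmod_eq_1_iff)
  have "cnj w ^ n * w ^ n = (w * cnj w) ^ n" by (simp add: power_mult_distrib mult.commute)
  then show "cnj w ^ n * w ^ n = 1" by (simp add: w)
qed

lemma params_in_block_params:
  assumes "cmod z = 1" "cmod w = 1" "cadjoint S ** S = mat 1" "det S = 1"
  shows "(scale_mat (cnj w ^ 4) (cnj_mat S), z * w ^ 5, cnj z * w ^ 5) \<in> block_params"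
proof -
  have "(z * w ^ 5 * (cnj z * w ^ 5))\<^sup>2 * det (scale_mat (cnj w ^ 4) (cnj_mat S)) =
      (z * cnj z)\<^sup>2 * (cnj w ^ 20 * w ^ 20)"
    using assms(4) by (simp add: det_scale_mat det_cnj_mat power_mult_distrib flip: power_mult power_add)
  moreover have "cadjoint (scale_mat (cnj w ^ 4) (cnj_mat S)) ** scale_mat (cnj w ^ 4) (cnj_mat S) =
      scale_mat (cnj w ^ 4 * w ^ 4) (transpose S ** cnj_mat S)"
    by (simp add: cadjoint_scale_mat scale_mat_mult scale_mat_scale_mat mult.commute)
  ultimately show ?thesis
    using assms by (simp add: block_params_def norm_mult norm_power unit_powers unitary_transpose scale_mat_one)
qed

lemma fixed_group_map_in:
  assumes "x \<in> carrier U1_U1_SU5"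
  shows "fixed_group_map x \<in> E6_gamma \<inter> E6_gammaH_rho2"
  using assms block_map_fixed[OF params_in_block_params]
  by (auto simp: fixed_group_map_def U1_def SU_def)

lemma fixed_group_map_Bij:
  assumes "x \<in> carrier U1_U1_SU5"
  shows "fixed_group_map x \<in> Bij jordanC"
  using fixed_group_map_in[OF assms] E6_Bij by (auto simp: E6_gamma_def)

lemma complex_nth_root_exists:
  fixes z :: complex
  assumes "n > 0" "z \<noteq> 0"
  obtains w where "w ^ n = z"
proof
  show "exp (Ln z / of_nat n) ^ n = z"
    using assms by (simp flip: exp_of_nat_mult)
qed

lemma fixed_group_map_surj:
  assumes "f \<in> E6_gamma \<inter> E6_gammaH_rho2"
  shows "f \<in> fixed_group_map ` carrier U1_U1_SU5"
proof -
  obtain A c d where p: "(A, c, d) \<in> block_params" and f: "f = block_map A c d"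
    using fixed_group_block_map[OF assms] .
  from p have A: "cadjoint A ** A = mat 1" and n: "cmod c = 1" "cmod d = 1" and det: "(c * d)\<^sup>2 * det A = 1"
    by (auto simp: block_params_def)
  have "c * d \<noteq> 0" using n by auto
  \<comment> \<open>The relations c = z w^5 and d = z^(-1) w^5 require w^10 = c d; any tenth root
    serves, and z and S are then determined by w.\<close>
  then obtain w where w: "w ^ 10 = c * d"
    using complex_nth_root_exists[of 10 "c * d"] by auto
  have "cmod w ^ 10 = 1"
    using n by (simp flip: norm_power add: w norm_mult)
  then have nw: "cmod w = 1"
    using power_eq_imp_eq_base[of "cmod w" 10 1] by simp
  define z where "z = c * cnj w ^ 5"
  define S where "S = cnj_mat (scale_mat (w ^ 4) A)"
  have nz: "cmod z = 1"
    by (simp add: z_def norm_mult norm_power n nw)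
  \<comment> \<open>In dimension five the scaling contributes w^20 = (c d)^2, so det S = 1 becomes
    the constraint in \<open>block_params\<close>.\<close>
  have "det (scale_mat (w ^ 4) A) = (w ^ 10)\<^sup>2 * det A"
    by (simp add: det_scale_mat flip: power_mult)
  then have "det S = 1"
    by (simp add: S_def det_cnj_mat det w)
  moreover have "cadjoint S ** S = mat 1"
  proof -
    have "cadjoint S ** S = scale_mat (cnj w ^ 4 * w ^ 4) (transpose A ** cnj_mat A)"
      by (simp add: S_def cnj_mat_scale_mat cadjoint_scale_mat scale_mat_mult scale_mat_scale_mat mult.commute)
    then show ?thesis
      by (simp add: unit_powers nw unitary_transpose A scale_mat_one)
  qed
  ultimately have "(z, w, S) \<in> carrier U1_U1_SU5"
    using nz nw by (simp add: U1_def SU_def)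
  moreover have "scale_mat (cnj w ^ 4) (cnj_mat S) = A"
    by (simp add: S_def scale_mat_scale_mat unit_powers nw scale_mat_one)
  moreover have "z * w ^ 5 = c"
    by (simp add: z_def mult.assoc unit_powers nw)
  moreover have "cnj z * w ^ 5 = cnj c * w ^ 10"
    by (simp add: z_def mult.assoc flip: power_add)
  then have "cnj z * w ^ 5 = d"
    using unit_powers(2)[OF n(1), of 1] by (simp add: w mult.assoc[symmetric])
  ultimately show ?thesis
    by (intro image_eqI[of _ _ "(z, w, S)"]) (simp_all add: f fixed_group_map_def)
qed

lemma fixed_group_map_image: "fixed_group_map ` carrier U1_U1_SU5 = E6_gamma \<inter> E6_gammaH_rho2"
  using fixed_group_map_in fixed_group_map_surj by blast

lemma mult_U1_U1_SU5: "(z, w, S) \<otimes>\<^bsub>U1_U1_SU5\<^esub> (z', w', S') = (z * z', w * w', S ** S')"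
  by (simp add: U1_def SU_def)

lemma fixed_group_map_mult:
  assumes "x \<in> carrier U1_U1_SU5" "y \<in> carrier U1_U1_SU5"
  shows "fixed_group_map (x \<otimes>\<^bsub>U1_U1_SU5\<^esub> y) = fixed_group_map x \<otimes>\<^bsub>BijGroup jordanC\<^esub> fixed_group_map y"
proof -
  obtain z w S z' w' S' where x: "x = (z, w, S)" and y: "y = (z', w', S')"
    by (metis prod_cases3)
  have B: "fixed_group_map x \<in> Bij jordanC" "fixed_group_map y \<in> Bij jordanC"
    using assms by (auto intro: fixed_group_map_Bij simp del: carrier_DirProd)
  have "fixed_group_map (x \<otimes>\<^bsub>U1_U1_SU5\<^esub> y) = compose jordanC (fixed_group_map x) (fixed_group_map y)"
  proof
    fix X :: "complex omat"
    have 1: "scale_mat (cnj w ^ 4) (cnj_mat S) ** scale_mat (cnj w' ^ 4) (cnj_mat S') =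
        scale_mat (cnj (w * w') ^ 4) (cnj_mat (S ** S'))"
      by (simp add: scale_mat_mult scale_mat_scale_mat cnj_mat_mult power_mult_distrib mult.commute)
    have 2: "z * w ^ 5 * (z' * w' ^ 5) = z * z' * (w * w') ^ 5"
      "cnj z * w ^ 5 * (cnj z' * w' ^ 5) = cnj (z * z') * (w * w') ^ 5"
      by (simp_all add: power_mult_distrib mult_ac)
    show "fixed_group_map (x \<otimes>\<^bsub>U1_U1_SU5\<^esub> y) X = compose jordanC (fixed_group_map x) (fixed_group_map y) X"
    proof (cases "X \<in> jordan")
      case True
      then show ?thesis
        unfolding x y mult_U1_U1_SU5 by (simp only: fixed_group_map_def compose_eq split block_map_compose 1 2)
    next
      case False
      then show ?thesis
        unfolding x y mult_U1_U1_SU5 by (simp add: fixed_group_map_def compose_def block_map_def)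
    qed
  qed
  with B show ?thesis
    by (simp add: BijGroup_def)
qed

lemma group_hom_fixed_group_map:
  "group_hom U1_U1_SU5 (BijGroup jordanC) fixed_group_map"
proof -
  have "fixed_group_map \<in> hom U1_U1_SU5 (BijGroup jordanC)"
  proof (rule homI)
    fix x assume "x \<in> carrier U1_U1_SU5"
    then show "fixed_group_map x \<in> carrier (BijGroup jordanC)"
      using fixed_group_map_Bij by (simp add: BijGroup_def)
  qed (rule fixed_group_map_mult)
  then show ?thesis
    by (intro group_hom.intro group_U1_U1_SU5 group_BijGroup group_hom_axioms.intro)
qed

section \<open>The kernel of the parametrisation\<close>

lemma block_map_eq_one_iff:
  "block_map A c d = (\<lambda>X\<in>jordanC. X) \<longleftrightarrow> A = mat 1 \<and> c = 1 \<and> d = 1"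
proof
  assume eq: "block_map A c d = (\<lambda>X\<in>jordanC. X)"
  \<comment> \<open>Taking s = t = 1 and v arbitrary exposes c, d and A at once.\<close>
  have "block_map A c d (jmk v 0 1 0 1 0) = jmk v 0 1 0 1 0" for v
    unfolding eq by simp
  then have "A *v v = v \<and> c = 1 \<and> d = 1" for v
    by (simp add: block_map_jmk) (metis coord_jmk(1,2,4))
  then show "A = mat 1 \<and> c = 1 \<and> d = 1"
    by (simp add: matrix_eq)
next
  assume "A = mat 1 \<and> c = 1 \<and> d = 1"
  moreover have "block_map (mat 1) 1 1 X = (\<lambda>X\<in>jordanC. X) X" for X
    by (cases "X \<in> jordan") (simp add: block_map_one, simp add: block_map_def)
  ultimately show "block_map A c d = (\<lambda>X\<in>jordanC. X)"
    by auto
qed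

text \<open>The powers of \<nu> with exponent below 5 are distinct, and there are only five fifth
  roots of unity, so counting shows that none is missed.\<close>

lemma fifth_root_of_unity_power:
  fixes \<nu> :: complex
  assumes "\<nu> ^ 5 = 1" "\<forall>k\<in>{1..<5::nat}. \<nu> ^ k \<noteq> 1" and "u ^ 5 = 1"
  shows "\<exists>k<5. u = \<nu> ^ k"
proof -
  have nz: "\<nu> \<noteq> 0" using assms(1) by auto
  have "i = j" if "i \<le> j" "j < 5" "\<nu> ^ i = \<nu> ^ j" for i j :: nat
  proof (rule ccontr)
    assume "i \<noteq> j"
    have "\<nu> ^ j = \<nu> ^ i * \<nu> ^ (j - i)" using that(1) by (simp flip: power_add)
    with that nz have "\<nu> ^ (j - i) = 1" by simp
    with assms(2) \<open>i \<noteq> j\<close> that show False by (auto dest!: bspec[of _ _ "j - i"])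
  qed
  then have "inj_on (\<lambda>k. \<nu> ^ k) {..<5}"
    by (intro inj_onI) (metis lessThan_iff nat_le_linear)
  then have "card ((\<lambda>k. \<nu> ^ k) ` {..<5}) = card {z :: complex. z ^ 5 = 1}"
    by (simp add: card_image card_roots_unity_eq)
  moreover have "(\<lambda>k. \<nu> ^ k) ` {..<5} \<subseteq> {z. z ^ 5 = 1}"
    using assms(1) by auto (metis mult.commute power_mult power_one)
  ultimately have "(\<lambda>k. \<nu> ^ k) ` {..<5} = {z. z ^ 5 = 1}"
    by (intro card_subset_eq finite_roots_unity) auto
  with assms(3) show ?thesis by blast
qed

lemma kernel_fixed_group_map:
  fixes \<nu> :: complex
  assumes "\<nu> ^ 5 = 1" "\<forall>k\<in>{1..<5::nat}. \<nu> ^ k \<noteq> 1"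
  shows "kernel U1_U1_SU5 (BijGroup jordanC) fixed_group_map = Z2_sub <#>\<^bsub>U1_U1_SU5\<^esub> Z5_sub \<nu>"
proof -
  have N: "Z2_sub <#>\<^bsub>U1_U1_SU5\<^esub> Z5_sub \<nu> =
      {(e, e * \<nu> ^ k, mat (\<nu> ^ k)) | e k. e \<in> {1, -1} \<and> k < 5}" (is "_ = ?N")
  proof -
    have k5: "k \<in> {0, 1, 2, 3, 4} \<longleftrightarrow> k < 5" for k :: nat by auto
    show ?thesis
      unfolding set_mult_def Z2_sub_def Z5_sub_def k5 by (auto simp: mult_U1_U1_SU5 simp del: mult_DirProd)
  qed
  have "x \<in> kernel U1_U1_SU5 (BijGroup jordanC) fixed_group_map \<longleftrightarrow> x \<in> ?N" for x
  proof -
    obtain z w S where x: "x = (z, w, S)" by (metis prod_cases3)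
    have ker: "x \<in> kernel U1_U1_SU5 (BijGroup jordanC) fixed_group_map \<longleftrightarrow>
      cmod z = 1 \<and> cmod w = 1 \<and> cadjoint S ** S = mat 1 \<and> det S = 1 \<and>
      scale_mat (cnj w ^ 4) (cnj_mat S) = mat 1 \<and> z * w ^ 5 = 1 \<and> cnj z * w ^ 5 = 1"
      by (auto simp: x kernel_def U1_def SU_def fixed_group_map_def BijGroup_def block_map_eq_one_iff)
    show ?thesis
    proof
      assume "x \<in> kernel U1_U1_SU5 (BijGroup jordanC) fixed_group_map"
      with ker have n: "cmod z = 1" "cmod w = 1" and S: "scale_mat (cnj w ^ 4) (cnj_mat S) = mat 1"
        and zw: "z * w ^ 5 = 1" "cnj z * w ^ 5 = 1"
        by auto
      \<comment> \<open>Both equations share the nonzero factor w^5, so z is real and hence 1 or -1;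
        then w^5 = z, which makes z w a fifth root of unity.\<close>
      have "cnj z = z"
        using zw by (metis mult_cancel_right mult_zero_right zero_neq_one)
      then have z2: "z * z = 1"
        using unit_powers(1)[OF n(1)] by simp
      then have z: "z \<in> {1, -1}"
        by (simp add: square_eq_1_iff)
      then have zz: "z ^ 5 = z" "z ^ 4 = 1"
        by auto
      then have "(z * w) ^ 5 = 1"
        by (simp add: power_mult_distrib zw)
      then obtain k where k: "k < 5" "z * w = \<nu> ^ k"
        using fifth_root_of_unity_power[OF assms] by blast
      have w: "w = z * \<nu> ^ k"
        using z2 by (simp flip: k(2) mult.assoc)
      have "cnj (scale_mat (cnj w ^ 4) (cnj_mat S) $ i $ j) = cnj ((mat 1 :: complex^5^5) $ i $ j)" for i j
        unfolding S ..
      then have "w ^ 4 * S $ i $ j = (if i = j then 1 else 0)" for i j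
        by (simp add: mat_def split: if_splits)
      \<comment> \<open>Since z^4 = 1, w^4 equals \<nu>^(4k), whose inverse is \<nu>^k; multiplying
        w^4 S = E by \<nu>^k yields S.\<close>
      moreover have "w ^ 4 * \<nu> ^ k = 1"
      proof -
        have "w ^ 4 * \<nu> ^ k = (\<nu> ^ k) ^ 5"
          by (simp add: w power_mult_distrib zz flip: power_Suc2)
        also have "\<dots> = (\<nu> ^ 5) ^ k"
          by (simp flip: power_mult add: mult.commute)
        finally show ?thesis by (simp add: assms)
      qed
      moreover have "S $ i $ j = (w ^ 4 * \<nu> ^ k) * S $ i $ j" if "w ^ 4 * \<nu> ^ k = 1" for i j
        using that by simp
      then have "S $ i $ j = \<nu> ^ k * (w ^ 4 * S $ i $ j)" if "w ^ 4 * \<nu> ^ k = 1" for i j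
        using that by (metis mult.assoc mult.commute)
      ultimately have "S $ i $ j = mat (\<nu> ^ k) $ i $ j" for i j
        by (simp add: mat_def split: if_splits)
      then have "S = mat (\<nu> ^ k)"
        by (simp add: vec_eq_iff)
      with z w k show "x \<in> ?N"
        unfolding x by blast
    next
      assume "x \<in> ?N"
      then obtain k where z: "z = 1 \<or> z = -1" and k: "w = z * \<nu> ^ k" "S = mat (\<nu> ^ k)"
        by (auto simp: x)
      define u where "u = \<nu> ^ k"
      have u5: "u ^ 5 = 1"
        unfolding u_def by (metis assms(1) mult.commute power_mult power_one)
      then have "cmod u ^ 5 = 1"
        by (metis norm_one norm_power)
      then have nu: "cmod u = 1"
        using power_eq_imp_eq_base[of "cmod u" 5 1] by simp
      have zz: "z ^ 5 = z" "z ^ 4 = 1" "cnj z = z" "z * z = 1" "cmod z = 1"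
        using z by auto
      have Sk: "S = scale_mat u (mat 1)"
        by (simp add: k(2) u_def vec_eq_iff mat_def)
      have m1: "cnj_mat (mat 1) = (mat 1 :: complex^5^5)" by simp
      have "cadjoint S ** S = mat 1"
        using unit_powers(1)[OF nu]
        by (simp add: Sk cadjoint_scale_mat scale_mat_mult scale_mat_scale_mat scale_mat_one)
      moreover have "scale_mat (cnj w ^ 4) (cnj_mat S) = scale_mat (cnj (u ^ 5)) (mat 1)"
        by (simp add: Sk cnj_mat_scale_mat scale_mat_scale_mat k(1) zz power_mult_distrib flip: u_def power_Suc2)
      ultimately show "x \<in> kernel U1_U1_SU5 (BijGroup jordanC) fixed_group_map"
        unfolding ker using u5 nu zz
        by (simp add: scale_mat_one k(1) power_mult_distrib norm_mult flip: u_def) (simp add: Sk det_scale_mat)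
    qed
  qed
  then show ?thesis
    unfolding N by blast
qed

section \<open>Topology\<close>

text \<open>A continuous surjection from a compact space onto a Hausdorff space is a quotient map.
  So h and the coset projection are quotient maps on the same source, and the induced bijection is a
  homeomorphism; its inverse is the isomorphism from H.\<close>

lemma compact_group_first_isomorphism:
  fixes G :: "('a::t2_space, 'b) monoid_scheme" and H :: "('c::topological_space, 'd) monoid_scheme"
  assumes hom: "group_hom G H h" and img: "h ` carrier G = carrier H"
    and compact: "compact (carrier G)" and cont: "continuous_on (carrier G) h"
    and Hausdorff: "Hausdorff_space (top_of_set (carrier H))"
  shows "topological_group_iso H (top_of_set (carrier H))
    (G Mod kernel G H h) (quotient_group_topology G (kernel G H h))"
proof -
  interpret group_hom G H h by (rule hom)
  let ?N = "kernel G H h" and ?X = "top_of_set (carrier G)" and ?Y = "top_of_set (carrier H)"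
  let ?Q = "quotient_group_topology G ?N" and ?g = "\<lambda>C. the_elem (h ` C)"
  have g_coset: "?g (?N #>\<^bsub>G\<^esub> x) = h x" if x: "x \<in> carrier G" for x
  proof -
    have "h ` (?N #>\<^bsub>G\<^esub> x) = {h x}"
    proof -
      have "h ` (?N #>\<^bsub>G\<^esub> x) \<subseteq> {h x}"
        using x by (auto simp: r_coset_def kernel_def)
      moreover have "x \<in> ?N #>\<^bsub>G\<^esub> x"
        using x by (rule G.rcos_self) (rule subgroup_kernel)
      ultimately show ?thesis by blast
    qed
    then show ?thesis by simp
  qed
  have iso: "?g \<in> iso (G Mod ?N) H"
    by (rule FactGroup_iso_set[OF img])
  then have bij: "bij_betw ?g (carrier (G Mod ?N)) (carrier H)"
    by (simp add: iso_def)
  have contm: "continuous_map ?X ?Y h"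
    using cont img by (simp add: continuous_map_in_subtopology)
  have "quotient_map ?X ?Y h"
    by (rule continuous_imp_quotient_map[OF contm _ Hausdorff])
      (use compact img in \<open>auto simp: compact_space_subtopology compactin_euclidean_iff\<close>)
  then have "quotient_map ?X ?Y (?g \<circ> (\<lambda>x. ?N #>\<^bsub>G\<^esub> x))"
    by (rule quotient_map_eq) (simp add: g_coset)
  moreover have "quotient_map ?X ?Q (\<lambda>x. ?N #>\<^bsub>G\<^esub> x)"
    by (rule quotient_map_quotient_group_topology)
  ultimately have "quotient_map ?Q ?Y ?g"
    by (meson quotient_map_from_composition continuous_compose_quotient_map quotient_imp_continuous_map)
  then have "homeomorphic_map ?Q ?Y ?g"
    using bij by (simp add: homeomorphic_map_def bij_betw_def)
  then obtain f where f: "homeomorphic_maps ?Q ?Y ?g f"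
    by (auto simp: homeomorphic_map_maps)
  \<comment> \<open>The topological inverse f is identified with \<open>inv_into\<close>, the
    inverse for which \<open>iso_set_sym\<close> gives the isomorphism, so that one map carries both
    structures.\<close>
  have inv_f: "f y = inv_into (carrier (G Mod ?N)) ?g y" if "y \<in> carrier H" for y
  proof -
    have "f y \<in> carrier (G Mod ?N)" "?g (f y) = y"
      using f that by (auto simp: homeomorphic_maps_def continuous_map_def Pi_iff)
    then show ?thesis
      using bij by (metis bij_betw_def inv_into_f_f)
  qed
  have "homeomorphic_maps ?Q ?Y ?g (inv_into (carrier (G Mod ?N)) ?g)"
    by (rule homeomorphic_maps_eq[OF f]) (simp_all add: inv_f)
  then have "homeomorphic_map ?Y ?Q (inv_into (carrier (G Mod ?N)) ?g)"
    by (simp add: homeomorphic_maps_map)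
  moreover have "inv_into (carrier (G Mod ?N)) ?g \<in> iso H (G Mod ?N)"
    using iso normal.factorgroup_is_group[OF normal_kernel] by (simp add: group.iso_set_sym)
  ultimately show ?thesis
    unfolding topological_group_iso_def by blast
qed

section \<open>Continuity of the parametrisation\<close>

lemma Hausdorff_space_fun: "Hausdorff_space (euclidean :: ('a \<Rightarrow> 'b::metric_space) topology)"
  by (simp flip: euclidean_product_topology add: Hausdorff_space_product_topology)

text \<open>Serves to make \<open>jmk\<close> continuous, as linear maps on finite-dimensional
  spaces are.\<close>

lemma linear_jmk: "linear (\<lambda>(v, W, s, p, t, q). jmk v W s p t q)"
proof (rule linearI)
  fix x y show "(case x + y of (v, W, s, p, t, q) \<Rightarrow> jmk v W s p t q) =
      (case x of (v, W, s, p, t, q) \<Rightarrow> jmk v W s p t q) + (case y of (v, W, s, p, t, q) \<Rightarrow> jmk v W s p t q)"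
    by (cases x; cases y) (simp add: jmk_add)
next
  fix r :: real and x :: "(complex^5) \<times> (complex^5^5) \<times> complex \<times> (complex^5) \<times> complex \<times> (complex^5)"
  have sc: "omat_scale (of_real r) X = r *\<^sub>R X" for X :: "complex omat"
  proof -
    have "oct_scale (of_real r) x = r *\<^sub>R x" for x :: "complex oct"
      by (cases x rule: oct_cases) (simp add: oct_scale_def scaleR_conv_of_real)
    then show ?thesis
      by (simp add: vec_eq_iff omat_scale_def omat_map_def)
  qed
  obtain v W s p t q where x: "x = (v, W, s, p, t, q)" by (metis prod_cases6)
  have "jmk (r *\<^sub>R v) (r *\<^sub>R W) (r *\<^sub>R s) (r *\<^sub>R p) (r *\<^sub>R t) (r *\<^sub>R q) = r *\<^sub>R jmk v W s p t q"
    unfolding sc[symmetric] jmk_scale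
    by (rule arg_cong6[where f = jmk]) (simp_all add: vec_eq_iff scaleR_conv_of_real[where 'a = complex])
  then show "(case r *\<^sub>R x of (v, W, s, p, t, q) \<Rightarrow> jmk v W s p t q) =
      r *\<^sub>R (case x of (v, W, s, p, t, q) \<Rightarrow> jmk v W s p t q)"
    by (simp add: x)
qed

lemma continuous_on_jmk:
  assumes "continuous_on S v" "continuous_on S W" "continuous_on S s" "continuous_on S p" "continuous_on S t" "continuous_on S q"
  shows "continuous_on S (\<lambda>x. jmk (v x) (W x) (s x) (p x) (t x) (q x))"
proof -
  have "continuous_on S (\<lambda>x. (\<lambda>(v, W, s, p, t, q). jmk v W s p t q) (v x, W x, s x, p x, t x, q x))"
    by (rule continuous_on_compose2[OF linear_continuous_on[OF linear_conv_bounded_linear[THEN iffD1, OF linear_jmk]] _ subset_UNIV])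
      (intro continuous_on_Pair assms)
  then show ?thesis by simp
qed

lemma continuous_on_fixed_group_map: "continuous_on S fixed_group_map"
proof (rule continuous_on_coordinatewise_then_product)
  \<comment> \<open>In the topology of pointwise convergence X may be fixed. On
    \<open>jordan\<close> the value is \<open>jmk\<close> of polynomials in z, w, S and their
    conjugates; elsewhere it is constantly \<open>undefined\<close>.\<close>
  fix X :: "complex omat"
  show "continuous_on S (\<lambda>x. fixed_group_map x X)"
  proof (cases "X \<in> jordan")
    case True
    then have "(\<lambda>x. fixed_group_map x X) = (\<lambda>x. jmk
        (scale_mat (cnj (fst (snd x)) ^ 4) (cnj_mat (snd (snd x))) *v coord_v X)
        (scale_mat (fst x * fst (snd x) ^ 5 * (cnj (fst x) * fst (snd x) ^ 5))
          (scale_mat (cnj (fst (snd x)) ^ 4) (cnj_mat (snd (snd x))) ** coord_W X **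
            transpose (scale_mat (cnj (fst (snd x)) ^ 4) (cnj_mat (snd (snd x))))))
        (fst x * fst (snd x) ^ 5 * coord_s X)
        (cnj (cnj (fst x) * fst (snd x) ^ 5) *s (cnj_mat (scale_mat (cnj (fst (snd x)) ^ 4) (cnj_mat (snd (snd x)))) *v coord_p X))
        (cnj (fst x) * fst (snd x) ^ 5 * coord_t X)
        (cnj (fst x * fst (snd x) ^ 5) *s (cnj_mat (scale_mat (cnj (fst (snd x)) ^ 4) (cnj_mat (snd (snd x)))) *v coord_q X)))"
      by (auto simp: fixed_group_map_def block_map_def)
    moreover have "continuous_on S \<dots>"
      unfolding scale_mat_def cnj_mat_def matrix_vector_mult_def matrix_matrix_mult_def transpose_def vector_scalar_mult_def
      by (intro continuous_on_jmk continuous_intros continuous_on_vec_lambda)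
    ultimately show ?thesis by (simp only:)
  next
    case False
    then have "fixed_group_map x X = undefined" for x
      by (cases x) (simp add: fixed_group_map_def block_map_def)
    then show ?thesis by simp
  qed
qed

section \<open>Compactness of the source group\<close>

lemma norm_unitary_entry:
  fixes A :: "complex^'n^'n"
  assumes "cadjoint A ** A = mat 1"
  shows "cmod (A $ i $ j) \<le> 1"
proof -
  \<comment> \<open>A diagonal entry of the unitarity relation says that a column is a unit
    vector.\<close>
  have "(\<Sum>k\<in>UNIV. cnj (A $ k $ j) * A $ k $ j) = 1"
    using arg_cong[OF assms, of "\<lambda>M. M $ j $ j"] by (simp add: matrix_matrix_mult_def mat_def)
  moreover have "cnj z * z = of_real ((cmod z)\<^sup>2)" for z
    using complex_norm_square[of z] by (simp add: mult.commute)
  ultimately have "complex_of_real (\<Sum>k\<in>UNIV. (cmod (A $ k $ j))\<^sup>2) = of_real 1"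
    by simp
  then have "(\<Sum>k\<in>UNIV. (cmod (A $ k $ j))\<^sup>2) = 1"
    by (simp only: of_real_eq_iff)
  moreover have "(cmod (A $ i $ j))\<^sup>2 \<le> (\<Sum>k\<in>UNIV. (cmod (A $ k $ j))\<^sup>2)"
    by (rule member_le_sum) auto
  ultimately show ?thesis
    by (simp add: abs_square_le_1)
qed

lemma norm_vec_le_sum:
  fixes x :: "'a::real_normed_vector^'n"
  shows "norm x \<le> (\<Sum>i\<in>UNIV. norm (x $ i))"
  by (simp add: norm_vec_def L2_set_le_sum)

lemma compact_SU: "compact (carrier (SU :: (complex^'n^'n) monoid))"
proof -
  have "bounded (carrier (SU :: (complex^'n^'n) monoid))"
  proof (rule boundedI)
    fix A :: "complex^'n^'n" assume "A \<in> carrier SU"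
    then have A: "cadjoint A ** A = mat 1" by (simp add: SU_def)
    have "norm A \<le> (\<Sum>i\<in>UNIV. norm (A $ i))" by (rule norm_vec_le_sum)
    also have "\<dots> \<le> (\<Sum>i\<in>(UNIV :: 'n set). \<Sum>j\<in>(UNIV :: 'n set). 1)"
      by (rule sum_mono, rule order_trans[OF norm_vec_le_sum], rule sum_mono, rule norm_unitary_entry[OF A])
    finally show "norm A \<le> (\<Sum>i\<in>(UNIV :: 'n set). \<Sum>j\<in>(UNIV :: 'n set). 1)" .
  qed
  \<comment> \<open>The defining equations are polynomial in the entries and their conjugates, hence
    continuous.\<close>
  moreover have "closed (carrier (SU :: (complex^'n^'n) monoid))"
    unfolding SU_def cadjoint_def matrix_matrix_mult_def det_def partial_object.simps
    by (intro closed_Collect_conj closed_Collect_eq continuous_intros continuous_on_vec_lambda)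
  ultimately show ?thesis
    by (simp add: compact_eq_bounded_closed)
qed

lemma compact_U1_U1_SU5: "compact (carrier U1_U1_SU5)"
proof -
  have "carrier U1 = sphere 0 1" by (auto simp: U1_def)
  then show ?thesis by (simp add: compact_Times compact_SU)
qed

theorem theorem4p10p5:
  fixes \<nu> :: complex
  assumes "\<nu> ^ 5 = 1" and "\<forall>k\<in>{1..<5::nat}. \<nu> ^ k \<noteq> 1"
  defines "K \<equiv> E6\<lparr>carrier := E6_gamma \<inter> E6_gammaH_rho2\<rparr>"
    and "N \<equiv> Z2_sub <#>\<^bsub>U1_U1_SU5\<^esub> Z5_sub \<nu>"
  shows "topological_group_iso
    K (top_of_set (carrier K))
    (U1_U1_SU5 Mod N) (quotient_group_topology U1_U1_SU5 N)"
proof -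
  interpret B: group_hom U1_U1_SU5 "BijGroup jordanC" fixed_group_map
    by (rule group_hom_fixed_group_map)
  \<comment> \<open>\<open>E6\<close> takes its operations from \<open>BijGroup jordanC\<close>, so
    K is that group restricted to the image of a homomorphism, which is a subgroup.\<close>
  have K: "K = (BijGroup jordanC)\<lparr>carrier := fixed_group_map ` carrier U1_U1_SU5\<rparr>"
    by (simp add: K_def E6_def fixed_group_map_image del: carrier_DirProd)
  have "group_hom U1_U1_SU5 K fixed_group_map"
  proof (intro group_hom.intro group_hom_axioms.intro group_U1_U1_SU5)
    show "group K"
      unfolding K by (rule subgroup.subgroup_is_group[OF B.img_is_subgroup group_BijGroup])
    show "fixed_group_map \<in> hom U1_U1_SU5 K"
      using B.homh by (auto simp: K hom_def simp del: carrier_DirProd)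
  qed
  moreover have "kernel U1_U1_SU5 K fixed_group_map = N"
    using kernel_fixed_group_map[OF assms(1,2)] by (simp add: K N_def kernel_def del: carrier_DirProd)
  moreover have "Hausdorff_space (top_of_set (carrier K))"
    by (intro Hausdorff_space_subtopology Hausdorff_space_fun)
  moreover have "fixed_group_map ` carrier U1_U1_SU5 = carrier K"
    by (simp add: K)
  ultimately show ?thesis
    using compact_group_first_isomorphism[OF _ _ compact_U1_U1_SU5 continuous_on_fixed_group_map] by metis
qed

end
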